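(* Let $n,k$ be integers with $k\ge 3$ and $n\ge\frac{13}{3}k-2$, and let $f_{\mathrm{inv}}:\mathbb F_{2^n}\to\mathbb F_{2^n}$ be defined by $f_{\mathrm{inv}}(x)=x^{-1}$ for $x\neq0$ and $f_{\mathrm{inv}}(0)=0$. Then $f_{\mathrm{inv}}$ is not $k$th order sum-free.
   Context: A function $f:\mathbb F_{2^n}\to\mathbb F_{2^n}$ is called $k$th order sum-free if for every $k$-dimensional affine subspace $X$ of $\mathbb F_{2^n}$ (viewed as a vector space over $\mathbb F_2$) one has $\sum_{x\in X} f(x)\neq 0$. *)

theory Defs
  imports Main
begin

text \<open>A finite field with 2^n elements is (up to isomorphism) F_{2^n}; we work over an
arbitrary finite field type of that cardinality. Over F_2, a set B is linearly independent
iff distinct subsets of B have distinct sums (equivalently no nonempty subset sums to 0).\<close>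

definition F2_lin_indep :: "'a::ab_group_add set \<Rightarrow> bool" where
  "F2_lin_indep B \<longleftrightarrow> finite B \<and> (\<forall>S\<subseteq>B. S \<noteq> {} \<longrightarrow> sum id S \<noteq> 0)"

text \<open>k-dimensional affine subspace over F_2: a translate a + span(B) with B a basis of
k linearly independent vectors; span over F_2 = all subset sums.\<close>
definition affine_subspace_dim :: "nat \<Rightarrow> 'a::ab_group_add set \<Rightarrow> bool" where
  "affine_subspace_dim k X \<longleftrightarrow>
     (\<exists>a B. F2_lin_indep B \<and> card B = k \<and> X = {a + sum id S | S. S \<subseteq> B})"

definition sum_free_order :: "nat \<Rightarrow> ('a::ab_group_add \<Rightarrow> 'a) \<Rightarrow> bool" where
  "sum_free_order k f \<longleftrightarrow> (\<forall>X. affine_subspace_dim k X \<longrightarrow> (\<Sum>x\<in>X. f x) \<noteq> 0)"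

definition f_inv :: "'a::field \<Rightarrow> 'a" where
  "f_inv x = (if x = 0 then 0 else inverse x)"

end

theory Submission
  imports Defs "HOL-Analysis.Convex"
begin

text \<open>For a subspace \<open>E\<close> of \<open>F = F\<^bsub>2^n\<^esub>\<close> let \<open>L E y = \<Prod>u\<in>E. y + u\<close>, an additive polynomial, and let
  \<open>sig E\<close> be the sum of the inverses of the elements of \<open>E\<close> divided by the product of the nonzero ones.
  For \<open>v \<notin> H\<close> and \<open>w = L H v\<close> one has \<open>sig (H + v) w\<^sup>2 = 1 + w sig H\<close>, so a \<open>k\<close>-dimensional subspace
  with vanishing sum of inverses exists iff \<open>w sig H = 1\<close> for some \<open>H\<close> of dimension \<open>k - 1\<close> and some
  \<open>w\<close> in the range of \<open>L H\<close>. The annihilator of this range consists of \<open>0\<close> and the \<open>1 / w\<^sup>2\<close>, where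
  \<open>w\<close> now belongs to the hyperplanes of \<open>H\<close>. Averaging over all \<open>H\<close>, the error term of a count over
  dimension \<open>j + 1\<close> therefore becomes a count of the same shape over dimension \<open>j\<close>, with the weight
  \<open>f\<close> replaced by \<open>a \<mapsto> fourier f (1 / (1 + a))\<close>. Starting from the indicator of \<open>1\<close>, two steps lead
  to Kloosterman sums, and two applications of Cauchy-Schwarz, separated by a third step, reduce the
  estimate to the second and fourth moments of Kloosterman sums, which are elementary. This replaces
  the Lang-Weil bound and suffices for \<open>n \<ge> 4 k\<close>; only \<open>k = 3\<close> needs separate numerics.\<close>

section \<open>Arithmetic in characteristic 2 and fibres of additive maps\<close>

locale char2_field =
  fixes ty :: "'a::{field,finite} itself" and q :: nat
  assumes one_add_one: "(1::'a) + 1 = 0"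
    and card_field [simp]: "card (UNIV :: 'a set) = q"
begin

lemma two_eq_zero [simp]: "(2::'a) = 0"
  using one_add_one by simp

lemma add_self [simp]: "x + x = (0::'a)"
  using mult_2[of x] by simp

lemma add_self_left [simp]: "x + (x + y) = (y::'a)"
  using add.assoc[of x x y] by simp

lemma uminus_eq [simp]: "- x = (x::'a)"
  by (simp add: minus_unique)

lemma add_eq_zero_iff: "x + y = 0 \<longleftrightarrow> x = (y::'a)"
proof
  assume "x + y = 0"
  then have "x + (x + y) = x" by simp
  then show "x = y" by (simp only: add_self_left)
qed simp

lemma square_add: "(x + y)^2 = x^2 + (y::'a)^2"
  by (simp add: power2_sum)

text \<open>Every nonempty fibre of an additive map is a translate of its kernel.\<close>

lemma sum_additive_comp:
  fixes \<phi> :: "'a \<Rightarrow> 'a" and g :: "'a \<Rightarrow> real"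
  assumes "\<And>x y. \<phi> (x + y) = \<phi> x + \<phi> y"
  shows "(\<Sum>x\<in>UNIV. g (\<phi> x)) = card {x. \<phi> x = 0} * (\<Sum>u\<in>range \<phi>. g u)"
proof -
  have fibre: "(\<Sum>x\<in>{x\<in>UNIV. \<phi> x = u}. g (\<phi> x)) = card {x. \<phi> x = 0} * g u" if u: "u \<in> range \<phi>" for u
  proof -
    obtain x0 where x0: "u = \<phi> x0" using u by auto
    have "{x\<in>UNIV. \<phi> x = u} = (+) x0 ` {x. \<phi> x = 0}"
    proof (safe)
      fix x assume "u = \<phi> x" "u = \<phi> x"
      then show "x \<in> (+) x0 ` {x. \<phi> x = 0}"
        using assms[of x0 x] x0 by (intro image_eqI[of _ _ "x0 + x"]) auto
    qed (use assms x0 in auto)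
    then have "card {x\<in>UNIV. \<phi> x = u} = card {x. \<phi> x = 0}"
      by (simp add: card_image)
    moreover have "(\<Sum>x\<in>{x\<in>UNIV. \<phi> x = u}. g (\<phi> x)) = (\<Sum>x\<in>{x\<in>UNIV. \<phi> x = u}. g u)"
      by (rule sum.cong) auto
    ultimately show ?thesis by simp
  qed
  have "(\<Sum>x\<in>UNIV. g (\<phi> x)) = (\<Sum>u\<in>range \<phi>. \<Sum>x\<in>{x\<in>UNIV. \<phi> x = u}. g (\<phi> x))"
    by (rule sum.image_gen) simp
  also have "\<dots> = (\<Sum>u\<in>range \<phi>. card {x. \<phi> x = 0} * g u)"
    by (rule sum.cong[OF refl]) (rule fibre)
  finally show ?thesis by (simp only: sum_distrib_left)
qed

lemma card_range_additive:
  fixes \<phi> :: "'a \<Rightarrow> 'a"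
  assumes "\<And>x y. \<phi> (x + y) = \<phi> x + \<phi> y"
  shows "card {x. \<phi> x = 0} * card (range \<phi>) = q"
proof -
  have "real q = real (card {x. \<phi> x = 0}) * real (card (range \<phi>))"
    using sum_additive_comp[OF assms, of "\<lambda>_. 1"] by simp
  then show ?thesis by (metis of_nat_eq_iff of_nat_mult)
qed

subsection \<open>The additive character\<close>

text \<open>This is \<open>(- 1)\<close> to the power of the absolute trace, by the additive form of Hilbert 90.\<close>

definition psi :: "'a \<Rightarrow> real" where
  "psi x = (if x \<in> range (\<lambda>t. t^2 + t) then 1 else - 1)"

lemma artin_schreier_add: "(x + y)^2 + (x + y) = (x^2 + x) + (y^2 + (y::'a))"
  by (simp add: square_add algebra_simps)

lemma artin_schreier_eq_zero: "{x::'a. x^2 + x = 0} = {0, 1}"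
proof -
  have "x^2 + x = x * (x + 1)" for x :: 'a by (simp add: power2_eq_square algebra_simps)
  then show ?thesis by (auto simp: add_eq_zero_iff)
qed

lemma card_range_artin_schreier: "2 * card (range (\<lambda>t::'a. t^2 + t)) = q"
  using card_range_additive[of "\<lambda>t. t^2 + t", OF artin_schreier_add]
  by (simp add: artin_schreier_eq_zero)

lemma range_artin_schreier_add:
  "x \<in> range (\<lambda>t::'a. t^2 + t) \<Longrightarrow> y \<in> range (\<lambda>t. t^2 + t) \<Longrightarrow> x + y \<in> range (\<lambda>t. t^2 + t)"
  by (auto simp: artin_schreier_add[symmetric] simp del: power2_sum)

text \<open>The kernel of \<open>t^2 + t\<close> is \<open>{0, 1}\<close>, so its range is a
  subgroup of index 2 and the sum of two elements outside it lies inside.\<close>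

lemma psi_add: "psi (x + y) = psi x * psi y"
proof -
  let ?A = "range (\<lambda>t::'a. t^2 + t)"
  have index2: "x + y \<in> ?A" if "x \<notin> ?A" "y \<notin> ?A"
  proof -
    have disj: "?A \<inter> (+) x ` ?A = {}"
    proof (rule equals0I)
      fix b assume b: "b \<in> ?A \<inter> (+) x ` ?A"
      from b have "b \<in> (+) x ` ?A" by (rule IntD2)
      then obtain a where a: "a \<in> ?A" "b = x + a" by (rule imageE)
      from a(1) IntD1[OF b] have "a + b \<in> ?A" by (rule range_artin_schreier_add)
      then show False using that(1) a(2) by (simp only: add.left_commute[of a x] add_self add_0_right)
    qed
    have "card (?A \<union> (+) x ` ?A) = card ?A + card ((+) x ` ?A)"
      using disj by (intro card_Un_disjoint) simp_all
    also have "\<dots> = card (UNIV :: 'a set)"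
      using card_range_artin_schreier by (simp add: card_image)
    finally have "?A \<union> (+) x ` ?A = UNIV"
      by (intro card_subset_eq) simp_all
    then have "y \<in> ?A \<union> (+) x ` ?A" by (simp only: UNIV_I)
    then have "y \<in> (+) x ` ?A" by (rule UnE) (use that(2) in simp_all)
    then obtain a where a: "a \<in> ?A" "y = x + a" by (rule imageE)
    then show ?thesis by (simp only: add_self_left)
  qed
  have mixed: "x + y \<notin> ?A" if "x \<in> ?A" "y \<notin> ?A" for x y
    using range_artin_schreier_add[OF that(1), of "x + y"] that(2) by (simp only: add_self_left) metis
  show ?thesis
  proof (cases "x \<in> ?A"; cases "y \<in> ?A")
    assume "x \<notin> ?A" "y \<in> ?A"
    moreover from this have "x + y \<notin> ?A" using mixed[of y x] by (simp only: add.commute not_False_eq_True)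
    ultimately show ?thesis unfolding psi_def by (simp only: if_True if_False)
  qed (use index2 mixed[of x y] range_artin_schreier_add[of x y] in \<open>simp_all only: psi_def if_True if_False mult_minus_left mult_1 minus_minus not_False_eq_True\<close>)
qed

lemma psi_artin_schreier [simp]: "psi (t^2 + t) = 1"
  by (auto simp: psi_def)

lemma psi_zero [simp]: "psi 0 = 1"
  using psi_artin_schreier[of 0] by simp

lemma psi_cases: "psi x = 1 \<or> psi x = - 1"
  by (auto simp: psi_def)

lemma psi_mult_self [simp]: "psi x * psi x = 1" and psi_abs [simp]: "\<bar>psi x\<bar> = 1"
  using psi_cases[of x] by auto

lemma psi_square: "psi (x^2) = psi x"
proof -
  have "psi (x^2) = psi ((x^2 + x) + x)" by (simp only: add.assoc add_self add_0_right)
  also have "\<dots> = psi x" by (simp only: psi_add[of "x^2 + x"] psi_artin_schreier mult_1)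
  finally show ?thesis .
qed

lemma sum_shift: "(\<Sum>x\<in>UNIV. f (c + x)) = (\<Sum>x\<in>UNIV. f (x::'a) :: real)"
  by (rule sum.reindex_bij_witness[of _ "\<lambda>x. c + x" "\<lambda>x. c + x"]) auto

text \<open>For nonzero \<open>b\<close>, translating by \<open>c / b\<close> with
  \<open>psi c = - 1\<close> negates the sum.\<close>

lemma sum_psi_mult: "(\<Sum>x\<in>UNIV. psi (b * x)) = (if b = 0 then q else 0)"
proof (cases "b = 0")
  case False
  have "\<exists>c. psi c = - 1"
  proof (rule ccontr)
    assume "\<nexists>c. psi c = - 1"
    then have "c \<in> range (\<lambda>t. t^2 + t)" for c :: 'a
      using psi_cases[of c] by (metis psi_def)
    then have "range (\<lambda>t::'a. t^2 + t) = UNIV"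
      by (rule UNIV_eq_I[symmetric])
    then show False using card_range_artin_schreier finite_UNIV_card_ge_0[where 'a='a] by simp
  qed
  then obtain c where c: "psi c = - 1" ..
  have "(\<Sum>x\<in>UNIV. psi (b * x)) = (\<Sum>x\<in>UNIV. psi (b * (c / b + x)))"
    by (rule sum_shift[symmetric])
  also have "\<dots> = - (\<Sum>x\<in>UNIV. psi (b * x))"
    using False c by (simp add: distrib_left psi_add sum_negf)
  finally show ?thesis using False by simp
qed simp

definition fourier :: "('a \<Rightarrow> real) \<Rightarrow> 'a \<Rightarrow> real" where
  "fourier f b = (\<Sum>v\<in>UNIV. psi (b * v) * f v)"

text \<open>Summing over \<open>b\<close> first leaves only the pairs with \<open>d x = d y\<close>.
  The identity \<open>d\<close> gives Parseval; another \<open>d\<close> serves in the fourth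
  moment.\<close>

lemma parseval_comp:
  fixes f :: "'a \<Rightarrow> real" and d :: "'a \<Rightarrow> 'a"
  shows "(\<Sum>b\<in>UNIV. (\<Sum>x\<in>UNIV. psi (b * d x) * f x)^2)
    = q * (\<Sum>x\<in>UNIV. \<Sum>y\<in>{y. d y = d x}. f x * f y)"
proof -
  have "(\<Sum>b\<in>UNIV. (\<Sum>x\<in>UNIV. psi (b * d x) * f x)^2)
      = (\<Sum>b\<in>UNIV. \<Sum>x\<in>UNIV. \<Sum>y\<in>UNIV. psi ((d x + d y) * b) * (f x * f y))"
    by (simp add: power2_eq_square sum_product distrib_right distrib_left psi_add mult_ac)
  also have "\<dots> = (\<Sum>x\<in>UNIV. \<Sum>y\<in>UNIV. \<Sum>b\<in>UNIV. psi ((d x + d y) * b) * (f x * f y))"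
    by (subst sum.swap, rule sum.cong[OF refl], rule sum.swap)
  also have "\<dots> = (\<Sum>x\<in>UNIV. \<Sum>y\<in>UNIV. if d y = d x then q * (f x * f y) else 0)"
    by (intro sum.cong refl) (auto simp: sum_distrib_right[symmetric] sum_psi_mult add_eq_zero_iff)
  also have "\<dots> = q * (\<Sum>x\<in>UNIV. \<Sum>y\<in>{y. d y = d x}. f x * f y)"
    by (simp add: sum.If_cases sum_distrib_left)
  finally show ?thesis .
qed

lemma parseval:
  fixes f :: "'a \<Rightarrow> real"
  shows "(\<Sum>b\<in>UNIV. (fourier f b)^2) = q * (\<Sum>x\<in>UNIV. (f x)^2)"
proof -
  have "{y. y = x} = {x}" for x :: 'a by auto
  then show ?thesis
    using parseval_comp[of "\<lambda>x. x" f] by (simp add: fourier_def power2_eq_square)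
qed

subsection \<open>Subspaces and hyperplanes\<close>

definition subsp :: "'a set \<Rightarrow> bool" where
  "subsp E \<longleftrightarrow> 0 \<in> E \<and> (\<forall>x\<in>E. \<forall>y\<in>E. x + y \<in> E)"

definition ext :: "'a set \<Rightarrow> 'a \<Rightarrow> 'a set" where
  "ext H v = H \<union> (+) v ` H"

definition hyp :: "'a set \<Rightarrow> 'a set set" where
  "hyp E = {H. subsp H \<and> H \<subseteq> E \<and> 2 * card H = card E}"

lemma subsp_zero: "subsp E \<Longrightarrow> 0 \<in> E"
  and subsp_add: "subsp E \<Longrightarrow> x \<in> E \<Longrightarrow> y \<in> E \<Longrightarrow> x + y \<in> E"
  by (auto simp: subsp_def)

lemma subsp_add_iff: "subsp E \<Longrightarrow> x \<in> E \<Longrightarrow> x + y \<in> E \<longleftrightarrow> y \<in> E"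
  using subsp_add[of E x "x + y"] subsp_add[of E x y] by auto

lemma subsp_add_iff': "subsp E \<Longrightarrow> x \<in> E \<Longrightarrow> y + x \<in> E \<longleftrightarrow> y \<in> E"
  using subsp_add_iff[of E x y] by (simp add: add.commute)

lemma translate_mem_iff: "(x :: 'a) \<in> (+) v ` H \<longleftrightarrow> v + x \<in> H"
  by (auto intro: image_eqI[of _ _ "v + x"])

lemma ext_mem_iff: "x \<in> ext H v \<longleftrightarrow> x \<in> H \<or> v + x \<in> H"
  by (simp add: ext_def translate_mem_iff)

lemma subsp_ext:
  assumes "subsp H"
  shows "subsp (ext H v)"
proof -
  have "x + y \<in> ext H v" if "x \<in> ext H v" "y \<in> ext H v" for x y
  proof -
    have "v + (x + y) = (v + x) + y" "v + (x + y) = x + (v + y)" "x + y = (v + x) + (v + y)"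
      by (simp_all add: add_ac)
    then show ?thesis
      using that subsp_add[OF assms, of x y] subsp_add[OF assms, of "v + x" y]
        subsp_add[OF assms, of x "v + y"] subsp_add[OF assms, of "v + x" "v + y"]
      by (simp only: ext_mem_iff) presburger
  qed
  then show ?thesis
    using assms by (auto simp: subsp_def ext_mem_iff)
qed

lemma translate_disjoint: "subsp H \<Longrightarrow> v \<notin> H \<Longrightarrow> H \<inter> (+) v ` H = {}"
  by (auto simp: subsp_add_iff')

lemma card_ext: "subsp H \<Longrightarrow> v \<notin> H \<Longrightarrow> card (ext H v) = 2 * card H"
  unfolding ext_def by (subst card_Un_disjoint) (simp_all add: translate_disjoint card_image)

lemma ext_subset: "subsp E \<Longrightarrow> H \<subseteq> E \<Longrightarrow> v \<in> E \<Longrightarrow> ext H v \<subseteq> E"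
  by (auto simp: ext_def subsp_add)

lemma ext_self: "subsp H \<Longrightarrow> v \<in> ext H v"
  by (simp add: ext_mem_iff subsp_zero)

lemma subset_ext: "H \<subseteq> ext H v"
  by (auto simp: ext_def)

lemma ext_cong: "subsp H \<Longrightarrow> v + v' \<in> H \<Longrightarrow> ext H v = ext H v'"
proof (rule set_eqI)
  fix x assume "subsp H" "v + v' \<in> H"
  moreover have "v' + x = (v + v') + (v + x)" by (simp add: add_ac)
  ultimately show "x \<in> ext H v \<longleftrightarrow> x \<in> ext H v'"
    by (simp only: ext_mem_iff subsp_add_iff)
qed

text \<open>A maximal subspace of \<open>E\<close> satisfying \<open>P\<close> must be
  \<open>E\<close>, since otherwise a vector of \<open>E\<close> can be adjoined.\<close>

lemma subsp_induct [consumes 1, case_names zero ext]: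
  assumes "subsp E" "P {0}" "\<And>H v. subsp H \<Longrightarrow> v \<notin> H \<Longrightarrow> P H \<Longrightarrow> P (ext H v)"
  shows "P E"
proof -
  let ?S = "{H. subsp H \<and> H \<subseteq> E \<and> P H}"
  have "{0} \<in> ?S" using assms by (auto simp: subsp_def)
  then obtain H where H: "H \<in> ?S" "\<And>K. K \<in> ?S \<Longrightarrow> H \<subseteq> K \<Longrightarrow> H = K"
    using finite_has_maximal[of ?S] by auto
  have "H = E"
  proof (rule ccontr)
    assume "H \<noteq> E"
    then obtain v where v: "v \<in> E" "v \<notin> H" using H(1) by auto
    then have "ext H v \<in> ?S" using assms H(1) by (auto intro: subsp_ext ext_subset[THEN subsetD])
    then have "H = ext H v" by (rule H(2)) (rule subset_ext)
    then show False using v ext_self[of H v] H(1) by auto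
  qed
  then show ?thesis using H by auto
qed

lemma hyp_ext_eq: "subsp E \<Longrightarrow> H \<in> hyp E \<Longrightarrow> v \<in> E \<Longrightarrow> v \<notin> H \<Longrightarrow> ext H v = E"
  by (rule card_subset_eq) (auto simp: hyp_def card_ext ext_subset)

lemma hyp_ext: "subsp H \<Longrightarrow> v \<notin> H \<Longrightarrow> H \<in> hyp (ext H v)"
  by (auto simp: hyp_def card_ext subset_ext)

lemma hyp_subsp: "H \<in> hyp E \<Longrightarrow> subsp H"
  and hyp_subset: "H \<in> hyp E \<Longrightarrow> H \<subseteq> E"
  and hyp_card: "H \<in> hyp E \<Longrightarrow> 2 * card H = card E"
  by (auto simp: hyp_def)

lemma subsp_card_pos: "subsp E \<Longrightarrow> 0 < card E"
  using subsp_zero by (auto simp: card_gt_0_iff)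

lemma hyp_complement: "H \<in> hyp E \<Longrightarrow> \<exists>y. y \<in> E \<and> y \<notin> H"
proof -
  assume "H \<in> hyp E"
  then have "card H < card E"
    using subsp_card_pos[OF hyp_subsp, of H E] hyp_card[of H E] by simp
  then have "\<not> E \<subseteq> H" using card_mono[of H E] by auto
  then show ?thesis by auto
qed

definition pt :: "'a set \<Rightarrow> 'a set \<Rightarrow> 'a" where
  "pt H E = (SOME y. y \<in> E \<and> y \<notin> H)"

lemma pt: "H \<in> hyp E \<Longrightarrow> pt H E \<in> E" "H \<in> hyp E \<Longrightarrow> pt H E \<notin> H"
  using someI_ex[OF hyp_complement[of H E]] by (auto simp: pt_def)

subsection \<open>Subspace polynomials\<close>

definition L :: "'a set \<Rightarrow> 'a \<Rightarrow> 'a" where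
  "L E y = (\<Prod>u\<in>E. y + u)"

lemma L_ext:
  assumes "subsp H" "v \<notin> H"
  shows "L (ext H v) y = L H y * L H (v + y)"
proof -
  have "L (ext H v) y = L H y * (\<Prod>u\<in>(+) v ` H. y + u)"
    unfolding L_def ext_def using translate_disjoint[OF assms] by (intro prod.union_disjoint) auto
  also have "(\<Prod>u\<in>(+) v ` H. y + u) = L H (v + y)"
    unfolding L_def by (subst prod.reindex) (auto simp: add_ac)
  finally show ?thesis .
qed

text \<open>Adjoining \<open>v\<close> follows \<open>L H\<close> by
  \<open>a \<mapsto> a * (c + a)\<close> with \<open>c = L H v\<close>, which is additive because
  the cross term \<open>a * b\<close> occurs twice.\<close>

lemma L_add: "subsp E \<Longrightarrow> L E (x + y) = L E x + L E y"
proof (induction arbitrary: x y rule: subsp_induct)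
  case zero
  show ?case by (simp add: L_def)
next
  case (ext H v)
  have "(a + b) * (c + (a + b)) = a * (c + a) + b * (c + b)" for a b c :: 'a
  proof -
    have "(a + b) * (c + (a + b)) = a * (c + a) + b * (c + b) + (a * b + a * b)"
      by (simp only: algebra_simps)
    then show ?thesis by simp
  qed
  then show ?case by (simp only: L_ext[OF ext(1,2)] ext.IH)
qed

lemma L_eq_zero_iff: "L E y = 0 \<longleftrightarrow> y \<in> E"
  by (auto simp: L_def add_eq_zero_iff)

lemma L_eq_iff: "subsp E \<Longrightarrow> L E x = L E y \<longleftrightarrow> x + y \<in> E"
  using L_add[of E x y] by (metis L_eq_zero_iff add_eq_zero_iff)

lemma card_range_L: "subsp E \<Longrightarrow> card E * card (range (L E)) = q"
  using card_range_additive[of "L E", OF L_add] by (simp add: L_eq_zero_iff)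

text \<open>The choice of \<open>pt H E\<close> is immaterial: \<open>L H\<close> is constant on \<open>E - H\<close>, see \<open>hgt_eq\<close>.\<close>

definition hgt :: "'a set \<Rightarrow> 'a set \<Rightarrow> 'a" where
  "hgt H E = L H (pt H E)"

lemma hgt_eq:
  assumes "subsp E" "H \<in> hyp E" "y \<in> E" "y \<notin> H"
  shows "hgt H E = L H y"
proof -
  have "pt H E \<in> ext H y" using hyp_ext_eq[OF assms] pt(1)[OF assms(2)] by simp
  then have "y + pt H E \<in> H" using pt(2)[OF assms(2)] by (simp add: ext_mem_iff)
  then show ?thesis
    by (simp add: hgt_def L_eq_iff[OF hyp_subsp[OF assms(2)]] add.commute)
qed

lemma hgt_ext: "subsp H \<Longrightarrow> v \<notin> H \<Longrightarrow> hgt H (ext H v) = L H v"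
  by (rule hgt_eq) (auto intro: subsp_ext hyp_ext ext_self)

lemma hgt_nonzero: "H \<in> hyp E \<Longrightarrow> hgt H E \<noteq> 0"
  using pt[of H E] by (simp add: hgt_def L_eq_zero_iff)

subsection \<open>Sums of inverses\<close>

definition a0 :: "'a set \<Rightarrow> 'a" where
  "a0 E = (\<Prod>u\<in>E - {0}. u)"

definition sig :: "'a set \<Rightarrow> 'a" where
  "sig E = (\<Sum>u\<in>E. inverse u) / a0 E"

lemma a0_nonzero: "a0 E \<noteq> 0"
  by (simp add: a0_def)

lemma a0_ext:
  assumes "subsp H" "v \<notin> H"
  shows "a0 (ext H v) = a0 H * L H v"
proof -
  have "ext H v - {0} = (H - {0}) \<union> (+) v ` H"
    using assms by (auto simp: ext_def add_eq_zero_iff)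
  moreover have "(\<Prod>u\<in>(+) v ` H. u) = L H v"
    unfolding L_def by (subst prod.reindex) auto
  moreover have "(\<Prod>u\<in>(H - {0}) \<union> (+) v ` H. u) = (\<Prod>u\<in>H - {0}. u) * (\<Prod>u\<in>(+) v ` H. u)"
    using translate_disjoint[OF assms] by (intro prod.union_disjoint) auto
  ultimately show ?thesis by (simp add: a0_def)
qed

text \<open>Up to the factor \<open>L H y\<close>, the left-hand side is the derivative of the additive polynomial
  \<open>L H\<close>, which is the constant \<open>a0 H\<close>.\<close>

lemma sum_inverse_translate:
  "subsp H \<Longrightarrow> y \<notin> H \<Longrightarrow> (\<Sum>u\<in>H. inverse (y + u)) = a0 H / L H y"
proof (induction arbitrary: y rule: subsp_induct)
  case zero
  then show ?case by (simp add: a0_def L_def divide_inverse)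
next
  case (ext H v)
  have y: "y \<notin> H" "v + y \<notin> H" using ext.prems by (auto simp: ext_mem_iff)
  have "(\<Sum>u\<in>ext H v. inverse (y + u)) = (\<Sum>u\<in>H. inverse (y + u)) + (\<Sum>u\<in>(+) v ` H. inverse (y + u))"
    unfolding ext_def using translate_disjoint[OF ext(1,2)] by (intro sum.union_disjoint) auto
  also have "(\<Sum>u\<in>(+) v ` H. inverse (y + u)) = (\<Sum>u\<in>H. inverse ((v + y) + u))"
    by (subst sum.reindex) (auto simp: add_ac)
  also have "(\<Sum>u\<in>H. inverse (y + u)) + \<dots> = a0 H / L H y + a0 H / L H (v + y)"
    using ext.IH[OF y(1)] ext.IH[OF y(2)] by simp
  also have "\<dots> = a0 H * (L H y + L H (v + y)) / (L H y * L H (v + y))"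
    using y by (simp add: field_simps L_eq_zero_iff)
  also have "L H y + L H (v + y) = L H v"
    by (simp add: L_add[OF ext(1)] add_ac)
  finally show ?case by (simp only: L_ext[OF ext(1,2)] a0_ext[OF ext(1,2)])
qed

text \<open>The coset \<open>v + H\<close> contributes \<open>a0 H / L H v\<close> to the sum of
  inverses. Dividing by \<open>a0\<close> makes the recursion depend only on \<open>sig H\<close>
  and \<open>L H v\<close>.\<close>

lemma sig_ext:
  assumes "subsp H" "v \<notin> H"
  shows "sig (ext H v) * (L H v)^2 = 1 + sig H * L H v"
proof -
  have "(\<Sum>u\<in>ext H v. inverse u) = (\<Sum>u\<in>H. inverse u) + (\<Sum>u\<in>(+) v ` H. inverse u)"
    unfolding ext_def using translate_disjoint[OF assms] by (intro sum.union_disjoint) auto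
  also have "(\<Sum>u\<in>(+) v ` H. inverse u) = a0 H / L H v"
    using sum_inverse_translate[OF assms] by (subst sum.reindex) auto
  finally have "sig (ext H v) = ((\<Sum>u\<in>H. inverse u) + a0 H / L H v) / (a0 H * L H v)"
    by (simp add: sig_def a0_ext[OF assms])
  moreover have "L H v \<noteq> 0" using assms by (simp add: L_eq_zero_iff)
  ultimately show ?thesis
    using a0_nonzero[of H] by (simp add: sig_def field_simps power2_eq_square)
qed

lemma sig_hyp:
  assumes "subsp E" "H \<in> hyp E"
  shows "sig E * (hgt H E)^2 = 1 + sig H * hgt H E"
  using sig_ext[OF hyp_subsp[OF assms(2)] pt(2)[OF assms(2)]]
    hyp_ext_eq[OF assms pt[OF assms(2)]] by (simp add: hgt_def)

section \<open>Hyperplanes of an extended subspace\<close>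

lemma ext_Int:
  assumes "subsp E" "H \<subseteq> E" "z \<notin> E"
  shows "ext H z \<inter> E = H"
proof -
  have "z + x \<notin> H" if "x \<in> E" for x
    using that assms subsp_add_iff'[OF assms(1), of x z] by auto
  then show ?thesis using assms(2) by (auto simp: ext_mem_iff)
qed

lemma hyp_extend:
  assumes "subsp E" "v \<notin> E" "H \<in> hyp E" "z \<notin> E" "v + z \<in> E"
  shows "ext H z \<in> hyp (ext E v)"
proof -
  have z: "z \<in> ext E v" using assms by (simp add: ext_mem_iff)
  have "H \<subseteq> ext E v" using hyp_subset[OF assms(3)] subset_ext by fast
  then have "ext H z \<subseteq> ext E v"
    using z by (intro ext_subset subsp_ext assms(1))
  moreover have "z \<notin> H" using assms hyp_subset by blast
  ultimately show ?thesis
    using assms hyp_card[OF assms(3)] hyp_subsp[OF assms(3)]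
    by (simp add: hyp_def card_ext subsp_ext)
qed

text \<open>\<open>K\<close> meets \<open>E\<close> in a hyperplane \<open>H\<close> and is
  \<open>ext H z\<close> for any \<open>z\<close> in \<open>K - E\<close>. As \<open>E\<close> is
  made of the cosets of \<open>H\<close> through 0 and \<open>pt H E\<close>, such a
  \<open>z\<close> is \<open>v\<close> or \<open>v + pt H E\<close> modulo \<open>H\<close>.\<close>

lemma hyp_ext_cases:
  assumes E: "subsp E" "v \<notin> E" and K: "K \<in> hyp (ext E v)" "K \<noteq> E"
  obtains H where "H \<in> hyp E" "K = ext H v \<or> K = ext H (v + pt H E)"
proof -
  have cards: "card K = card E" using hyp_card[OF K(1)] card_ext[OF E] by simp
  have "\<not> K \<subseteq> E" using K(2) cards card_subset_eq[of E K] by auto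
  then obtain z where z: "z \<in> K" "z \<notin> E" by auto
  define H where "H = K \<inter> E"
  have sK: "subsp K" using K by (simp add: hyp_subsp)
  have sH: "subsp H" using sK E(1) by (auto simp: H_def subsp_def)
  have vE: "v + x \<in> E" if "x \<in> K" "x \<notin> E" for x
    using that hyp_subset[OF K(1)] by (auto simp: ext_mem_iff)
  have "K \<subseteq> ext H z"
  proof
    fix x assume x: "x \<in> K"
    show "x \<in> ext H z"
    proof (cases "x \<in> E")
      case False
      have "z + x = (v + z) + (v + x)" by (simp add: add_ac)
      also have "\<dots> \<in> E" using vE[OF z] vE[OF x False] by (rule subsp_add[OF E(1)])
      finally have "z + x \<in> E" .
      then show ?thesis using x z(1) subsp_add[OF sK] by (simp add: ext_mem_iff H_def)
    qed (use x in \<open>simp add: ext_mem_iff H_def\<close>)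
  qed
  then have Kz: "K = ext H z"
    using ext_subset[OF sK _ z(1), of H] by (auto simp: H_def)
  have zH: "z \<notin> H" using z by (simp add: H_def)
  have "2 * card H = card E"
    using cards card_ext[OF sH zH] by (simp only: Kz[symmetric])
  then have hyp: "H \<in> hyp E"
    using sH by (auto simp: hyp_def H_def)
  have "K = ext H v \<or> K = ext H (v + pt H E)"
  proof (cases "v + z \<in> H")
    case True
    then show ?thesis using ext_cong[OF sH, of z v] Kz by (simp add: add.commute)
  next
    case False
    have "v + z \<in> ext H (pt H E)"
      using vE[OF z] hyp_ext_eq[OF E(1) hyp pt[OF hyp]] by simp
    then have "z + (v + pt H E) \<in> H" using False by (simp add: ext_mem_iff add_ac)
    then show ?thesis using ext_cong[OF sH] Kz by simp
  qed
  with hyp show ?thesis by (rule that)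
qed

text \<open>Besides \<open>E\<close> itself there are exactly two lifts of each hyperplane
  \<open>H\<close> of \<open>E\<close>, and \<open>K \<inter> E\<close> recovers \<open>H\<close>
  from a lift \<open>K\<close>.\<close>

lemma sum_hyp_ext:
  fixes \<phi> :: "'a set \<Rightarrow> real"
  assumes E: "subsp E" "v \<notin> E"
  shows "(\<Sum>H\<in>hyp (ext E v). \<phi> H)
    = \<phi> E + (\<Sum>H\<in>hyp E. \<phi> (ext H v) + \<phi> (ext H (v + pt H E)))"
proof -
  let ?B = "\<lambda>H. {ext H v, ext H (v + pt H E)}"
  have out: "v + pt H E \<notin> E" if "H \<in> hyp E" for H
    using pt(1)[OF that] E by (simp add: subsp_add_iff')
  have "hyp (ext E v) = insert E (\<Union>H\<in>hyp E. ?B H)"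
  proof (intro equalityI subsetI)
    fix K assume "K \<in> hyp (ext E v)"
    then show "K \<in> insert E (\<Union>H\<in>hyp E. ?B H)"
      by (cases "K = E") (auto elim: hyp_ext_cases[OF E, of K])
  next
    fix K assume "K \<in> insert E (\<Union>H\<in>hyp E. ?B H)"
    then show "K \<in> hyp (ext E v)"
      using hyp_ext[OF E] hyp_extend[OF E] out pt(1) subsp_zero[OF E(1)] E(2) by auto
  qed
  moreover have "E \<notin> (\<Union>H\<in>hyp E. ?B H)"
  proof
    assume "E \<in> (\<Union>H\<in>hyp E. ?B H)"
    then obtain H where H: "H \<in> hyp E" "E = ext H v \<or> E = ext H (v + pt H E)" by auto
    have "v \<in> ext H v" "v + pt H E \<in> ext H (v + pt H E)"
      by (simp_all only: ext_self[OF hyp_subsp[OF H(1)]])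
    then have "v \<in> E \<or> v + pt H E \<in> E" using H(2) by (elim disjE) simp_all
    then show False using out[OF H(1)] E(2) by simp
  qed
  moreover have "?B H \<inter> ?B H' = {}" if H: "H \<in> hyp E" "H' \<in> hyp E" "H \<noteq> H'" for H H'
  proof -
    have trace: "K \<inter> E = H" if "K \<in> ?B H" "H \<in> hyp E" for K H
      using that ext_Int[OF E(1) hyp_subset[OF that(2)]] E(2) out by auto
    show "?B H \<inter> ?B H' = {}"
    proof (rule equals0I)
      fix K assume "K \<in> ?B H \<inter> ?B H'"
      then have "K \<inter> E = H" "K \<inter> E = H'" using trace H by (auto simp del: insert_iff)
      then show False using H(3) by simp
    qed
  qed
  then have "(\<Sum>K\<in>(\<Union>H\<in>hyp E. ?B H). \<phi> K) = (\<Sum>H\<in>hyp E. \<Sum>K\<in>?B H. \<phi> K)"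
    by (intro sum.UNION_disjoint) auto
  moreover have "(\<Sum>K\<in>?B H. \<phi> K) = \<phi> (ext H v) + \<phi> (ext H (v + pt H E))" if H: "H \<in> hyp E" for H
  proof -
    have "v \<notin> ext H (v + pt H E)"
      using pt(2)[OF H] hyp_subset[OF H] E(2) by (auto simp: ext_mem_iff add_ac)
    then have "ext H v \<noteq> ext H (v + pt H E)" using ext_self[OF hyp_subsp[OF H]] by metis
    then show ?thesis by simp
  qed
  ultimately show ?thesis by simp
qed

text \<open>The \<open>1 / (hgt H E)\<^sup>2\<close> are the nonzero elements of the annihilator of the range of \<open>L E\<close>
  under the pairing \<open>psi (x * y)\<close>, so this is orthogonality of characters.\<close>

lemma sum_psi_hyp:
  assumes "subsp E"
  shows "1 + (\<Sum>H\<in>hyp E. psi (u / (hgt H E)^2)) = (if u \<in> range (L E) then card E else 0)"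
  using assms
proof (induction arbitrary: u rule: subsp_induct)
  case zero
  have "hyp {0} = {}" using hyp_card[of _ "{0}"] by fastforce
  moreover have "range (L {0}) = UNIV" by (auto simp: L_def)
  ultimately show ?case by simp
next
  case (ext E v)
  let ?F = "ext E v"
  define w where "w = L E v"
  have w0: "w \<noteq> 0" using ext(2) by (simp add: w_def L_eq_zero_iff)
  have L_ext': "L ?F x = (L E x)^2 + w * L E x" for x
    by (simp add: L_ext[OF ext(1,2)] L_add[OF ext(1)] w_def power2_eq_square algebra_simps)
  \<comment> \<open>With \<open>b = L H (pt H E)\<close> and \<open>c = L H v\<close>, the heights
    of the two lifts and of \<open>E\<close> are \<open>b * (b + c)\<close>, \<open>b * c\<close>
    and \<open>c * (b + c)\<close>; their reciprocals sum to 0, which gives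
    \<open>split\<close>.\<close>
  have hyps: "hgt (ext H v) ?F = L H (pt H E) * (L H (pt H E) + L H v)" (is "_ = ?b * (?b + ?c)")
    "hgt (ext H (v + pt H E)) ?F = L H (pt H E) * L H v"
    "w = L H v * (L H (pt H E) + L H v)"
    "L H (pt H E) \<noteq> 0" "L H v \<noteq> 0" "L H (pt H E) + L H v \<noteq> 0"
    if H: "H \<in> hyp E" for H
  proof -
    note sH = hyp_subsp[OF H]
    note y = pt[OF H]
    have vy: "v + pt H E \<notin> E" using y(1) ext by (simp add: subsp_add_iff')
    then have vy': "v + pt H E \<notin> H" and v': "v \<notin> H" using hyp_subset[OF H] ext(2) by auto
    have yF: "pt H E \<in> ?F" using y by (simp add: ext_mem_iff)
    have 1: "ext H v \<in> hyp ?F" "ext H (v + pt H E) \<in> hyp ?F"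
      using hyp_extend[OF ext(1,2) H] ext(2) vy y(1) subsp_zero[OF ext(1)] by auto
    have 2: "pt H E \<notin> ext H v" "pt H E \<notin> ext H (v + pt H E)"
      using y vy' v' by (auto simp: ext_mem_iff add.assoc)
    show "hgt (ext H v) ?F = ?b * (?b + ?c)"
      by (subst hgt_eq[OF subsp_ext[OF ext(1)] 1(1) yF 2(1)])
        (simp add: L_ext[OF sH v'] L_add[OF sH] add.commute)
    show "hgt (ext H (v + pt H E)) ?F = ?b * ?c"
      by (subst hgt_eq[OF subsp_ext[OF ext(1)] 1(2) yF 2(2)])
        (simp add: L_ext[OF sH vy'] add.assoc)
    have "w = L (ext H (pt H E)) v"
      using hyp_ext_eq[OF ext(1) H y] by (simp add: w_def)
    then show "w = ?c * (?b + ?c)"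
      by (simp add: L_ext[OF sH y(2)] L_add[OF sH])
    show "?b \<noteq> 0" "?c \<noteq> 0" using y v' by (simp_all add: L_eq_zero_iff)
    show "?b + ?c \<noteq> 0" using vy' by (simp add: L_add[OF sH, symmetric] L_eq_zero_iff add.commute)
  qed
  have split: "psi (u / (hgt (ext H v) ?F)^2)
      = psi (u / (hgt (ext H (v + pt H E)) ?F)^2) * psi (u / w^2)" if H: "H \<in> hyp E" for H
  proof -
    define b c where "b = L H (pt H E)" and "c = L H v"
    note h = hyps[OF H, folded b_def c_def]
    have "1 / (b * (b + c)) = 1 / (b * c) + 1 / w"
    proof -
      have "1 / (b * c) = (b + c) / (b * c * (b + c))" "1 / w = b / (b * c * (b + c))"
        using h(4-6) by (simp_all add: h(3))
      then have "1 / (b * c) + 1 / w = (b + c + b) / (b * c * (b + c))"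
        by (simp only: add_divide_distrib)
      also have "b + c + b = c" by (simp add: add_ac)
      finally show ?thesis using h(4-6) by simp
    qed
    then have "(1 / (b * (b + c)))^2 = (1 / (b * c))^2 + (1 / w)^2"
      by (simp only: square_add)
    then have "u / (b * (b + c))^2 = u / (b * c)^2 + u / w^2"
      by (metis (no_types, opaque_lifting) distrib_left mult.right_neutral power_one
        power_divide times_divide_eq_right)
    then show ?thesis by (simp only: h(1,2) psi_add)
  qed
  have total: "1 + (\<Sum>H\<in>hyp ?F. psi (u / (hgt H ?F)^2)) = 1 + psi (u / w^2)
    + (\<Sum>H\<in>hyp E. psi (u / (hgt (ext H (v + pt H E)) ?F)^2) * (1 + psi (u / w^2)))"
    unfolding sum_hyp_ext[OF ext(1,2)]
    by (simp add: split hgt_ext[OF ext(1,2)] w_def distrib_left add.commute)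
  show ?case
  proof (cases "psi (u / w^2) = 1")
    \<comment> \<open>The factor \<open>1 + psi (u / w^2)\<close> in \<open>total\<close> vanishes,
      and an element \<open>u\<close> of the range would make \<open>u / w^2\<close> of the form
      \<open>t^2 + t\<close>.\<close>
    case False
    then have m1: "psi (u / w^2) = - 1" using psi_cases by metis
    have "u \<notin> range (L ?F)"
    proof
      assume "u \<in> range (L ?F)"
      then obtain x where "u = (L E x)^2 + w * L E x" by (auto simp: L_ext')
      then have "u / w^2 = (L E x / w)^2 + L E x / w"
        using w0 by (simp add: field_simps power2_eq_square)
      then show False using False by (simp only: psi_artin_schreier)
    qed
    then show ?thesis using total m1 by simp
  next
    case True
    then have "u / w^2 \<in> range (\<lambda>t. t^2 + t)" by (simp add: psi_def split: if_splits)
    then obtain t where t: "u / w^2 = t^2 + t" by auto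
    define p where "p = w * t"
    have u: "u = p^2 + w * p" using t w0 by (simp add: p_def field_simps power2_eq_square)
    \<comment> \<open>As \<open>psi\<close> is invariant under squaring,
      \<open>(p / (b * c))^2\<close> may be replaced by \<open>p / (b * c)\<close>; the two terms
      then combine to \<open>p / b^2\<close>, and the induction hypothesis applies to
      \<open>p\<close>.\<close>
    have "psi (u / (hgt (ext H (v + pt H E)) ?F)^2) = psi (p / (hgt H E)^2)" if H: "H \<in> hyp E" for H
    proof -
      define b c where "b = L H (pt H E)" and "c = L H v"
      note h = hyps[OF H, folded b_def c_def]
      have "u / (b * c)^2 = (p / (b * c))^2 + (b + c) * p / (b^2 * c)"
        unfolding u h(3) using h(4-6) by (simp add: field_simps power2_eq_square)
      then have "psi (u / (b * c)^2) = psi (p / (b * c) + (b + c) * p / (b^2 * c))"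
        by (simp only: psi_add psi_square)
      also have "p / (b * c) + (b + c) * p / (b^2 * c) = p * (b + (b + c)) / (b^2 * c)"
        using h(4-6) by (simp add: field_simps power2_eq_square)
      also have "\<dots> = p / b^2" using h(4-6) by simp
      finally show ?thesis by (simp only: h(2) hgt_def[of H] b_def[symmetric])
    qed
    then have "1 + (\<Sum>H\<in>hyp ?F. psi (u / (hgt H ?F)^2)) = 2 * (1 + (\<Sum>H\<in>hyp E. psi (p / (hgt H E)^2)))"
      unfolding total using True by (simp add: sum_distrib_left mult.commute)
    also have "\<dots> = (if p \<in> range (L E) then card ?F else 0)"
      by (simp add: ext.IH card_ext[OF ext(1,2)])
    \<comment> \<open>The other root of \<open>X^2 + w * X = u\<close> is \<open>p + w\<close>, and
      \<open>w = L E v\<close> also lies in the range of \<open>L E\<close>.\<close>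
    also have "p \<in> range (L E) \<longleftrightarrow> u \<in> range (L ?F)"
    proof
      assume "p \<in> range (L E)"
      then obtain x where "p = L E x" by auto
      then show "u \<in> range (L ?F)" by (auto simp: u L_ext')
    next
      assume "u \<in> range (L ?F)"
      then obtain x where "p^2 + w * p = (L E x)^2 + w * L E x" by (auto simp: u L_ext')
      then have eq: "(p^2 + w * p) + ((L E x)^2 + w * L E x) = 0" by (simp only: add_self)
      have "(p + L E x) * (p + L E x + w) = (p + L E x)^2 + w * (p + L E x)"
        by (simp add: power2_eq_square algebra_simps)
      also have "\<dots> = (p^2 + w * p) + ((L E x)^2 + w * L E x)"
        by (simp only: square_add distrib_left add_ac)
      finally have "(p + L E x) * (p + L E x + w) = 0" using eq by (simp only:)
      then have "p = L E x \<or> p + L E x = w" by (auto simp: add_eq_zero_iff)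
      then show "p \<in> range (L E)"
      proof (elim disjE)
        assume sum: "p + L E x = w"
        have "p = L E x + (p + L E x)" by (simp only: add.commute[of p] add_self_left)
        also have "\<dots> = L E (x + v)" by (simp only: sum L_add[OF ext(1)] w_def)
        finally show ?thesis by simp
      qed simp
    qed
    finally show ?thesis .
  qed
qed

subsection \<open>Averaging over subspaces\<close>

definition Gr :: "nat \<Rightarrow> 'a set set" where
  "Gr j = {E. subsp E \<and> card E = 2 ^ j}"

definition Zr :: "nat \<Rightarrow> 'a set set" where
  "Zr j = {E \<in> Gr j. sig E = 0}"

definition gr :: "nat \<Rightarrow> real" where
  "gr j = card (Gr j)"

definition zr :: "nat \<Rightarrow> real" where
  "zr j = card (Zr j)"

text \<open>By \<open>sum_Gr_hyp\<close> this is also the sum of \<open>f (sig H * hgt H E)\<close>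
  over all flags \<open>H \<in> hyp E\<close> with \<open>E \<in> Gr (Suc j)\<close>.\<close>

definition Psi :: "nat \<Rightarrow> ('a \<Rightarrow> real) \<Rightarrow> real" where
  "Psi j f = (\<Sum>E\<in>Gr j. \<Sum>u\<in>range (L E) - {0}. f (sig E * u))"

text \<open>\<open>a \<mapsto> inverse (1 + a)\<close> permutes the field, sending 1 to 0, so
  \<open>U f\<close> and \<open>fourier f\<close> have the same power moments.\<close>

definition U :: "('a \<Rightarrow> real) \<Rightarrow> 'a \<Rightarrow> real" where
  "U f a = fourier f (inverse (1 + a))"

lemma GrD: "E \<in> Gr j \<Longrightarrow> subsp E" "E \<in> Gr j \<Longrightarrow> card E = 2 ^ j"
  by (auto simp: Gr_def)

lemma hyp_Gr: "E \<in> Gr (Suc j) \<Longrightarrow> H \<in> hyp E \<Longrightarrow> H \<in> Gr j"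
  by (auto simp: Gr_def hyp_def)

text \<open>Subspaces one dimension above \<open>H\<close> correspond to nonzero cosets of
  \<open>H\<close>, and \<open>L H\<close> has kernel \<open>H\<close>.\<close>

lemma bij_betw_hgt:
  assumes H: "H \<in> Gr j"
  shows "bij_betw (hgt H) {E \<in> Gr (Suc j). H \<in> hyp E} (range (L H) - {0})"
proof (rule bij_betw_imageI)
  note sH = GrD(1)[OF H]
  show "inj_on (hgt H) {E \<in> Gr (Suc j). H \<in> hyp E}"
  proof (rule inj_onI)
    fix E F assume E: "E \<in> {E \<in> Gr (Suc j). H \<in> hyp E}" and F: "F \<in> {E \<in> Gr (Suc j). H \<in> hyp E}"
      and "hgt H E = hgt H F"
    then have "ext H (pt H E) = ext H (pt H F)"
      by (intro ext_cong sH) (simp add: hgt_def L_eq_iff[OF sH])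
    then show "E = F"
      using E F hyp_ext_eq[of E H "pt H E"] hyp_ext_eq[of F H "pt H F"] pt[of H E] pt[of H F] GrD(1)
      by auto
  qed
  show "hgt H ` {E \<in> Gr (Suc j). H \<in> hyp E} = range (L H) - {0}"
  proof (intro equalityI subsetI)
    fix w assume "w \<in> hgt H ` {E \<in> Gr (Suc j). H \<in> hyp E}"
    then show "w \<in> range (L H) - {0}" by (auto simp: hgt_nonzero) (simp add: hgt_def)
  next
    fix w assume "w \<in> range (L H) - {0}"
    then obtain y where y: "w = L H y" "y \<notin> H" by (auto simp: L_eq_zero_iff)
    then show "w \<in> hgt H ` {E \<in> Gr (Suc j). H \<in> hyp E}"
      using H by (intro image_eqI[of _ _ "ext H y"])
        (simp_all add: hgt_ext sH hyp_ext Gr_def subsp_ext card_ext)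
  qed
qed

lemma sum_Gr_hyp:
  fixes \<phi> :: "'a set \<Rightarrow> 'a \<Rightarrow> real"
  shows "(\<Sum>E\<in>Gr (Suc j). \<Sum>H\<in>hyp E. \<phi> H (hgt H E)) = (\<Sum>H\<in>Gr j. \<Sum>w\<in>range (L H) - {0}. \<phi> H w)"
proof -
  have "(\<Sum>E\<in>Gr (Suc j). \<Sum>H\<in>hyp E. \<phi> H (hgt H E))
      = (\<Sum>E\<in>Gr (Suc j). \<Sum>H\<in>{H \<in> Gr j. H \<in> hyp E}. \<phi> H (hgt H E))"
    using hyp_Gr by (intro sum.cong refl) auto
  also have "\<dots> = (\<Sum>H\<in>Gr j. \<Sum>E\<in>{E \<in> Gr (Suc j). H \<in> hyp E}. \<phi> H (hgt H E))"
    by (rule sum.swap_restrict) simp_all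
  also have "\<dots> = (\<Sum>H\<in>Gr j. \<Sum>w\<in>range (L H) - {0}. \<phi> H w)"
    using bij_betw_hgt by (intro sum.cong refl sum.reindex_bij_betw)
  finally show ?thesis .
qed

lemma card_hyp: "subsp E \<Longrightarrow> 1 + real (card (hyp E)) = card E"
  using sum_psi_hyp[of E 0] L_eq_zero_iff[of E 0] by (auto simp: subsp_zero image_iff)

text \<open>Poisson summation: \<open>sum_psi_hyp\<close> expands the indicator of the range into
  characters.\<close>

lemma sum_range_L:
  fixes f :: "'a \<Rightarrow> real"
  assumes "subsp E"
  shows "card E * (\<Sum>u\<in>range (L E). f u)
    = (\<Sum>u\<in>UNIV. f u) + (\<Sum>H\<in>hyp E. \<Sum>u\<in>UNIV. psi (u / (hgt H E)^2) * f u)"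
proof -
  have "card E * (\<Sum>u\<in>range (L E). f u) = (\<Sum>u\<in>UNIV. (if u \<in> range (L E) then card E else 0) * f u)"
    unfolding sum_distrib_left by (rule sum.mono_neutral_cong_left) auto
  also have "\<dots> = (\<Sum>u\<in>UNIV. f u + (\<Sum>H\<in>hyp E. psi (u / (hgt H E)^2) * f u))"
    by (simp add: sum_psi_hyp[OF assms, symmetric] distrib_right sum_distrib_right)
  also have "\<dots> = (\<Sum>u\<in>UNIV. f u) + (\<Sum>H\<in>hyp E. \<Sum>u\<in>UNIV. psi (u / (hgt H E)^2) * f u)"
    by (simp add: sum.distrib sum.swap[of _ UNIV])
  finally show ?thesis .
qed

lemma sum_scale: "s \<noteq> 0 \<Longrightarrow> (\<Sum>u\<in>UNIV. f (s * u)) = (\<Sum>u\<in>UNIV. f (u::'a) :: real)"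
  by (rule sum.reindex_bij_witness[of _ "\<lambda>u. u / s" "\<lambda>u. s * u"]) auto

text \<open>If \<open>sig E = 0\<close>, then \<open>1 + sig H * hgt H E = 0\<close> for all hyperplanes, and \<open>inverse 0 = 0\<close> turns the
  terms \<open>U f (sig H * hgt H E)\<close> into \<open>fourier f 0\<close>.\<close>

lemma sum_sig_range_L:
  fixes f :: "'a \<Rightarrow> real"
  assumes E: "subsp E"
  shows "card E * (\<Sum>u\<in>range (L E). f (sig E * u))
    = (if sig E = 0 then q * f 0 - card E * fourier f 0 else 0) + fourier f 0
      + (\<Sum>H\<in>hyp E. U f (sig H * hgt H E))"
proof (cases "sig E = 0")
  case True
  then have "1 + sig H * hgt H E = 0" if "H \<in> hyp E" for H
    using sig_hyp[OF E that] by simp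
  then have "(\<Sum>H\<in>hyp E. U f (sig H * hgt H E)) = card (hyp E) * fourier f 0"
    by (simp add: U_def)
  moreover have "real q = card E * card (range (L E))" using card_range_L[OF E] by simp
  ultimately show ?thesis
    using True by (simp add: card_hyp[OF E, symmetric] distrib_right)
next
  case False
  \<comment> \<open>Substituting \<open>sig E * u\<close> produces the frequency
    \<open>1 / (sig E * (hgt H E)^2)\<close>, which \<open>sig_hyp\<close> expresses through
    \<open>H\<close>.\<close>
  have "(\<Sum>u\<in>UNIV. psi (u / (hgt H E)^2) * f (sig E * u)) = U f (sig H * hgt H E)"
    if H: "H \<in> hyp E" for H
  proof -
    have "(\<Sum>u\<in>UNIV. psi (u / (hgt H E)^2) * f (sig E * u))
        = (\<Sum>u\<in>UNIV. (\<lambda>v. psi (inverse (sig E * (hgt H E)^2) * v) * f v) (sig E * u))"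
      using False hgt_nonzero[OF H] by (intro sum.cong refl) (simp add: field_simps)
    also have "\<dots> = fourier f (inverse (sig E * (hgt H E)^2))"
      unfolding fourier_def using False by (rule sum_scale)
    finally show ?thesis by (simp only: U_def sig_hyp[OF E H])
  qed
  moreover have "(\<Sum>u\<in>UNIV. f (sig E * u)) = fourier f 0"
    using sum_scale[OF False, of f] by (simp add: fourier_def)
  ultimately show ?thesis using False by (simp add: sum_range_L[OF E])
qed

text \<open>\<open>sum_sig_range_L\<close> is summed over \<open>E\<close>, the flags giving
  \<open>Psi j (U f)\<close>. The terms with \<open>f 0\<close> come from the excluded
  \<open>u = 0\<close> and from subspaces with \<open>sig E = 0\<close>.\<close>

lemma Psi_Suc:
  "2 ^ Suc j * Psi (Suc j) f = f 0 * (q * zr (Suc j) - 2 ^ Suc j * gr (Suc j))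
    + (gr (Suc j) - 2 ^ Suc j * zr (Suc j)) * fourier f 0 + Psi j (U f)"
proof -
  let ?c = "q * f 0 - 2 ^ Suc j * fourier f 0"
  have "2 ^ Suc j * (\<Sum>u\<in>range (L E) - {0}. f (sig E * u))
      = (if sig E = 0 then ?c else 0) + (fourier f 0 - 2 ^ Suc j * f 0)
        + (\<Sum>H\<in>hyp E. U f (sig H * hgt H E))" if E: "E \<in> Gr (Suc j)" for E
  proof -
    have "0 \<in> range (L E)"
      using L_eq_zero_iff[of E 0] subsp_zero[OF GrD(1)[OF E]] by (metis rangeI)
    then have "(\<Sum>u\<in>range (L E). f (sig E * u)) = f 0 + (\<Sum>u\<in>range (L E) - {0}. f (sig E * u))"
      by (subst sum.remove[of _ 0]) auto
    then show ?thesis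
      using sum_sig_range_L[OF GrD(1)[OF E], of f] GrD(2)[OF E]
      by (cases "sig E = 0") (simp_all only: of_nat_power of_nat_numeral distrib_left if_True if_False)
  qed
  then have "2 ^ Suc j * Psi (Suc j) f = (\<Sum>E\<in>Gr (Suc j). if sig E = 0 then ?c else 0)
      + gr (Suc j) * (fourier f 0 - 2 ^ Suc j * f 0)
      + (\<Sum>E\<in>Gr (Suc j). \<Sum>H\<in>hyp E. U f (sig H * hgt H E))"
    unfolding Psi_def sum_distrib_left by (simp add: sum.distrib gr_def)
  also have "(\<Sum>E\<in>Gr (Suc j). if sig E = 0 then ?c else 0) = zr (Suc j) * ?c"
    by (subst sum.inter_filter[symmetric]) (simp_all add: Zr_def zr_def)
  also have "(\<Sum>E\<in>Gr (Suc j). \<Sum>H\<in>hyp E. U f (sig H * hgt H E)) = Psi j (U f)"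
    unfolding Psi_def by (rule sum_Gr_hyp)
  finally show ?thesis by (simp add: algebra_simps)
qed

section \<open>Counting all subspaces and those with \<open>sig E = 0\<close>\<close>

lemma card_range_L_Gr: "H \<in> Gr j \<Longrightarrow> real (card (range (L H) - {0})) = q / 2 ^ j - 1"
proof -
  assume H: "H \<in> Gr j"
  have "0 \<in> range (L H)"
    using L_eq_zero_iff[of H 0] subsp_zero[OF GrD(1)[OF H]] by (metis rangeI)
  then have "card (range (L H)) = Suc (card (range (L H) - {0}))"
    by (intro card.remove) auto
  moreover have "real q = 2 ^ j * card (range (L H))"
    using card_range_L[OF GrD(1)[OF H]] GrD(2)[OF H] by (metis of_nat_mult of_nat_numeral of_nat_power)
  ultimately show ?thesis by (simp add: add_divide_distrib distrib_left)
qed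

lemma card_hyp_Gr: "E \<in> Gr j \<Longrightarrow> real (card (hyp E)) = 2 ^ j - 1"
  using card_hyp[of E] GrD[of E j] by simp

lemma gr_Suc: "gr (Suc j) * (2 ^ Suc j - 1) = gr j * (q / 2 ^ j - 1)"
proof -
  have "gr (Suc j) * (2 ^ Suc j - 1) = (\<Sum>E\<in>Gr (Suc j). \<Sum>H\<in>hyp E. 1 :: real)"
    by (simp add: card_hyp_Gr gr_def)
  also have "\<dots> = (\<Sum>H\<in>Gr j. \<Sum>w\<in>range (L H) - {0}. 1 :: real)"
    using sum_Gr_hyp[of "\<lambda>_ _. 1"] by simp
  also have "\<dots> = gr j * (q / 2 ^ j - 1)"
    by (simp add: card_range_L_Gr gr_def)
  finally show ?thesis .
qed

text \<open>If \<open>sig E = 0\<close>, every hyperplane of \<open>E\<close> satisfies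
  \<open>sig H * hgt H E = 1\<close>, otherwise none does. A given \<open>H\<close> admits at most
  one such height, \<open>inverse (sig H)\<close>.\<close>

lemma zr_Suc: "zr (Suc j) * (2 ^ Suc j - 1) \<le> gr j"
proof -
  have "zr (Suc j) * (2 ^ Suc j - 1) = (\<Sum>E\<in>Zr (Suc j). \<Sum>H\<in>hyp E. 1 :: real)"
  proof -
    have "(\<Sum>E\<in>Zr (Suc j). \<Sum>H\<in>hyp E. 1) = (\<Sum>E\<in>Zr (Suc j). 2 ^ Suc j - 1 :: real)"
      by (rule sum.cong) (auto simp: card_hyp_Gr Zr_def)
    then show ?thesis by (simp add: zr_def)
  qed
  also have "\<dots> = (\<Sum>E\<in>Gr (Suc j). if sig E = 0 then \<Sum>H\<in>hyp E. 1 else 0)"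
    unfolding Zr_def by (subst sum.inter_filter) simp_all
  also have "\<dots> = (\<Sum>E\<in>Gr (Suc j). \<Sum>H\<in>hyp E. if sig H * hgt H E = 1 then 1 else 0)"
  proof (rule sum.cong[OF refl])
    fix E assume E: "E \<in> Gr (Suc j)"
    have "sig E = 0 \<longleftrightarrow> sig H * hgt H E = 1" if "H \<in> hyp E" for H
      using sig_hyp[OF GrD(1)[OF E] that] hgt_nonzero[OF that]
      by (metis add_eq_zero_iff mult_eq_0_iff power_not_zero)
    then show "(if sig E = 0 then \<Sum>H\<in>hyp E. 1 else 0)
        = (\<Sum>H\<in>hyp E. if sig H * hgt H E = 1 then 1 else 0 :: real)"
      by (cases "sig E = 0") simp_all
  qed
  also have "\<dots> = (\<Sum>H\<in>Gr j. \<Sum>w\<in>range (L H) - {0}. if sig H * w = 1 then 1 else 0)"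
    by (rule sum_Gr_hyp)
  also have "\<dots> \<le> (\<Sum>H\<in>Gr j. 1)"
  proof (rule sum_mono)
    fix H
    have "(\<Sum>w\<in>range (L H) - {0}. if sig H * w = 1 then 1 else 0 :: real)
        \<le> (\<Sum>w\<in>range (L H) - {0}. if w = inverse (sig H) then 1 else 0)"
      by (rule sum_mono) (auto dest: inverse_unique)
    also have "\<dots> \<le> 1" by simp
    finally show "(\<Sum>w\<in>range (L H) - {0}. if sig H * w = 1 then 1 else 0 :: real) \<le> 1" .
  qed
  finally show ?thesis by (simp add: gr_def)
qed

lemma Gr_0: "Gr 0 = {{0}}"
  by (auto simp: Gr_def subsp_def card_1_singleton_iff)

lemma sig_0: "sig {0} = 0"
  by (simp add: sig_def)

text \<open>A positive count has a term with \<open>sig E * L E y = 1\<close>, and by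
  \<open>sig_ext\<close> adjoining this \<open>y\<close> makes \<open>sig\<close> vanish.\<close>

lemma exists_ext_sig_zero:
  assumes "0 < Psi j (\<lambda>a. if a = 1 then 1 else 0)"
  shows "Zr (Suc j) \<noteq> {}"
proof -
  have "\<exists>E\<in>Gr j. \<exists>u\<in>range (L E) - {0}. sig E * u = 1"
  proof (rule ccontr)
    assume "\<not> ?thesis"
    then have "Psi j (\<lambda>a. if a = 1 then 1 else 0) = 0"
      unfolding Psi_def by (intro sum.neutral ballI) auto
    then show False using assms by simp
  qed
  then obtain E u where E: "E \<in> Gr j" and u: "u \<in> range (L E) - {0}" "sig E * u = 1"
    by blast
  then obtain y where "u = L E y" by blast
  with u have y: "y \<notin> E" "sig E * L E y = 1" using L_eq_zero_iff[of E y] by simp_all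
  have "sig (ext E y) * (L E y)^2 = 0"
    using sig_ext[OF GrD(1)[OF E] y(1)] y(2) by simp
  then have "sig (ext E y) = 0" using y(1) by (simp add: L_eq_zero_iff)
  then have "ext E y \<in> Zr (Suc j)"
    using E y by (simp add: Zr_def Gr_def subsp_ext card_ext)
  then show ?thesis by auto
qed

lemma sum_inverse_Zr: "E \<in> Zr j \<Longrightarrow> (\<Sum>u\<in>E. inverse u) = 0"
  using a0_nonzero[of E] by (simp add: Zr_def sig_def)

subsection \<open>Moments\<close>

lemma sum_inverse_shift: "(\<Sum>a\<in>UNIV. g (inverse (1 + a))) = (\<Sum>b\<in>UNIV. g (b::'a) :: real)"
  by (rule sum.reindex_bij_witness[of _ "\<lambda>b. 1 + inverse b" "\<lambda>a. inverse (1 + a)"]) auto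

lemma sum_U_power: "(\<Sum>a\<in>UNIV. (U f a)^m) = (\<Sum>b\<in>UNIV. (fourier f b)^m)"
  unfolding U_def by (rule sum_inverse_shift)

text \<open>The outcome of one step from the indicator of 1; \<open>fourier f1 b\<close> is
  \<open>psi b\<close> times a Kloosterman sum.\<close>

definition f1 :: "'a \<Rightarrow> real" where
  "f1 a = psi (inverse (1 + a))"

lemma U_indicator: "U (\<lambda>a. if a = 1 then 1 else 0) = f1"
proof -
  have "fourier (\<lambda>a. if a = 1 then 1 else 0) b = psi b" for b
    unfolding fourier_def by (simp add: if_distrib[of "(*) _"] cong: if_cong)
  then show ?thesis by (auto simp: U_def f1_def)
qed

lemma fourier_f1_zero: "fourier f1 0 = 0"
  using sum_inverse_shift[of psi] sum_psi_mult[of 1] by (simp add: fourier_def f1_def)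

text \<open>Off \<open>{0, 1}\<close> the map \<open>d\<close> is \<open>1 / (y * (y + 1))\<close>,
  with fibres \<open>{y0, y0 + 1}\<close>; the points 0 and 1, where \<open>inverse 0 = 0\<close>
  enters, add at most two more.\<close>

lemma card_fibre_le_4:
  fixes x :: 'a
  defines "d \<equiv> \<lambda>y::'a. inverse y + inverse (y + 1)"
  shows "card {y. d y = d x} \<le> 4"
proof -
  have d_eq: "d y = 1 / (y * (y + 1))" if "y \<notin> {0, 1}" for y
  proof -
    have "y + 1 \<noteq> 0" "y \<noteq> 0" using that by (auto simp: add_eq_zero_iff)
    then have "d y = (y + 1 + y) / (y * (y + 1))" by (simp add: d_def field_simps)
    also have "y + 1 + y = 1" by (simp add: add_ac)
    finally show ?thesis .
  qed
  have "\<exists>y0. {y. d y = d x} \<subseteq> {0, 1, y0, y0 + 1}"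
  proof (cases "\<exists>y0. y0 \<notin> {0, 1} \<and> d y0 = d x")
    case True
    then obtain y0 where y0: "y0 \<notin> {0, 1}" "d y0 = d x" by blast
    have "y \<in> {0, 1, y0, y0 + 1}" if y: "d y = d x" for y
    proof (cases "y \<in> {0, 1}")
      case False
      then have "inverse (y * (y + 1)) = inverse (y0 * (y0 + 1))"
        using y0(2) y d_eq[OF False] d_eq[OF y0(1)] by (simp only: divide_inverse mult_1)
      then have "y * (y + 1) = y0 * (y0 + 1)" by (rule inverse_eq_imp_eq)
      then have eq: "y * (y + 1) + y0 * (y0 + 1) = 0" by simp
      have "(y + y0) * (y + y0 + 1) = y * (y + 1) + y0 * (y0 + 1) + (y * y0 + y * y0)"
        by (simp only: distrib_left distrib_right mult_ac add_ac)
      then have "(y + y0) * (y + y0 + 1) = 0" using eq by simp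
      then have "y = y0 \<or> y + (y0 + 1) = 0"
        by (auto simp: add_eq_zero_iff[of y y0] add.assoc)
      then show ?thesis by (auto simp: add_eq_zero_iff)
    qed auto
    then show ?thesis by auto
  qed auto
  then obtain y0 where "{y. d y = d x} \<subseteq> {0, 1, y0, y0 + 1}" by auto
  then have "card {y. d y = d x} \<le> card {0, 1, y0, y0 + 1}" by (intro card_mono) auto
  also have "\<dots> \<le> 4" by (auto intro!: card_insert_le_m1)
  finally show ?thesis .
qed

text \<open>The square of the Kloosterman sum \<open>K\<close> is the transform of the autocorrelation \<open>c\<close>; by scaling,
  \<open>c s\<close> only depends on the sum \<open>C (1 / s)\<close> over the fibres of \<open>d\<close>, which are small.\<close>

lemma fourth_moment: "(\<Sum>b\<in>UNIV. (fourier f1 b)^4) \<le> 5 * real q ^ 3"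
proof -
  define d where "d y = inverse y + inverse (y + 1)" for y :: 'a
  define K where "K b = (\<Sum>t\<in>UNIV. psi (b * t) * psi (inverse t))" for b
  define c where "c s = (\<Sum>x\<in>UNIV. psi (inverse x) * psi (inverse (x + s)))" for s
  define C where "C r = (\<Sum>x\<in>UNIV. psi (r * d x) * 1)" for r
  have "fourier f1 b = psi b * K b" for b
  proof -
    have "fourier f1 b = (\<Sum>t\<in>UNIV. psi (b * (1 + t)) * psi (inverse (1 + (1 + t))))"
      unfolding fourier_def f1_def by (rule sum_shift[symmetric])
    then show ?thesis
      by (simp add: K_def distrib_left psi_add sum_distrib_left mult.assoc del: add.assoc)
  qed
  then have sq: "(fourier f1 b)^2 = (K b)^2" for b
    by (simp add: power_mult_distrib power2_eq_square mult_ac)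
  have K2: "(K b)^2 = fourier c b" for b
  proof -
    have "(K b)^2 = (\<Sum>x\<in>UNIV. \<Sum>y\<in>UNIV. psi (b * x) * psi (inverse x) * (psi (b * y) * psi (inverse y)))"
      by (simp add: K_def power2_eq_square sum_product)
    also have "\<dots> = (\<Sum>x\<in>UNIV. \<Sum>s\<in>UNIV. psi (b * x) * psi (inverse x) * (psi (b * (x + s)) * psi (inverse (x + s))))"
      by (rule sum.cong[OF refl], rule sum_shift[symmetric])
    also have "\<dots> = (\<Sum>x\<in>UNIV. \<Sum>s\<in>UNIV. psi (b * s) * (psi (inverse x) * psi (inverse (x + s))))"
    proof (intro sum.cong refl)
      fix x s
      have "psi (b * x) * psi (inverse x) * (psi (b * (x + s)) * psi (inverse (x + s)))
        = (psi (b * x) * psi (b * x)) * (psi (b * s) * (psi (inverse x) * psi (inverse (x + s))))"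
        by (simp only: distrib_left psi_add mult_ac)
      then show "psi (b * x) * psi (inverse x) * (psi (b * (x + s)) * psi (inverse (x + s)))
        = psi (b * s) * (psi (inverse x) * psi (inverse (x + s)))" by simp
    qed
    also have "\<dots> = fourier c b"
      unfolding fourier_def c_def sum_distrib_left by (rule sum.swap)
    finally show ?thesis .
  qed
  have c0: "c 0 = q" by (simp add: c_def)
  have cs: "c s = C (inverse s)" if "s \<noteq> 0" for s
  proof -
    have "c s = (\<Sum>x\<in>UNIV. psi (inverse (s * x)) * psi (inverse (s * x + s)))"
      unfolding c_def using that by (rule sum_scale[symmetric])
    also have "\<dots> = C (inverse s)"
      unfolding C_def
    proof (rule sum.cong[OF refl])
      fix x
      have "inverse (s * x + s) = inverse s * inverse (x + 1)"
        by (metis distrib_left inverse_mult_distrib mult.right_neutral)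
      then show "psi (inverse (s * x)) * psi (inverse (s * x + s)) = psi (inverse s * d x) * 1"
        by (simp add: d_def distrib_left psi_add)
    qed
    finally show ?thesis .
  qed
  \<comment> \<open>\<open>parseval_comp\<close> with weight 1 counts the pairs with
    \<open>d x = d y\<close>, at most \<open>4 * q\<close> of them. With \<open>c 0 = q\<close> this
    yields the constant \<open>5 = 1 + 4\<close>.\<close>
  have "(\<Sum>r\<in>UNIV. (C r)^2) = q * (\<Sum>x\<in>UNIV. \<Sum>y\<in>{y. d y = d x}. 1 * 1 :: real)"
    unfolding C_def by (rule parseval_comp)
  also have "(\<Sum>x\<in>UNIV. \<Sum>y\<in>{y. d y = d x}. 1 * 1 :: real) \<le> (\<Sum>x\<in>(UNIV :: 'a set). 4 :: real)"
  proof (rule sum_mono)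
    fix x
    have "card {y. d y = d x} \<le> 4" using card_fibre_le_4[of x] by (simp add: d_def)
    then show "(\<Sum>y\<in>{y. d y = d x}. 1 * 1 :: real) \<le> 4" by simp
  qed
  finally have C2: "(\<Sum>r\<in>UNIV. (C r)^2) \<le> 4 * real q ^ 2"
    by (simp add: power2_eq_square mult_left_mono)
  have "(\<Sum>s\<in>UNIV. (c s)^2) = (c 0)^2 + (\<Sum>s\<in>UNIV - {0}. (c s)^2)"
    by (rule sum.remove) auto
  also have "(\<Sum>s\<in>UNIV - {0}. (c s)^2) = (\<Sum>s\<in>UNIV - {0}. (C (inverse s))^2)"
    by (rule sum.cong) (auto simp: cs)
  also have "\<dots> \<le> (\<Sum>s\<in>UNIV. (C (inverse s))^2)"
    by (rule sum_mono2) auto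
  also have "\<dots> = (\<Sum>r\<in>UNIV. (C r)^2)"
    by (rule sum.reindex_bij_witness[of _ inverse inverse]) auto
  finally have "(\<Sum>s\<in>UNIV. (c s)^2) \<le> 5 * real q ^ 2"
    using C2 by (simp add: c0)
  then have "q * (\<Sum>s\<in>UNIV. (c s)^2) \<le> q * (5 * real q ^ 2)"
    by (intro mult_left_mono) auto
  moreover have "(fourier f1 b)^4 = (fourier c b)^2" for b
    using power_mult[of "fourier f1 b" 2 2] by (simp add: sq K2)
  ultimately show ?thesis
    by (simp add: parseval) (simp add: power3_eq_cube power2_eq_square)
qed

section \<open>From subspaces in \<open>Zr k\<close> to the failure of sum-freeness\<close>

lemma exists_basis:
  "subsp E \<Longrightarrow> \<exists>B. F2_lin_indep B \<and> 2 ^ card B = card E \<and> E = {sum id S | S. S \<subseteq> B}"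
proof (induction rule: subsp_induct)
  case zero
  show ?case by (rule exI[of _ "{}"]) (auto simp: F2_lin_indep_def)
next
  case (ext H v)
  then obtain B where B: "F2_lin_indep B" "2 ^ card B = card H" "H = {sum id S | S. S \<subseteq> B}" by auto
  have fin: "finite S" for S :: "'a set" by simp
  have sub: "sum id S \<in> H" if "S \<subseteq> B" for S using that B(3) by auto
  have "B \<subseteq> H"
  proof
    fix b assume "b \<in> B"
    then show "b \<in> H" using sub[of "{b}"] by simp
  qed
  then have vB: "v \<notin> B" using ext(2) by auto
  have split: "sum id S = (if v \<in> S then v + sum id (S - {v}) else sum id (S - {v}))" for S
    by (simp add: sum.remove[OF fin, of v])
  have sub': "sum id (S - {v}) \<in> H" if "S \<subseteq> insert v B" for S
    using that by (intro sub) auto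
  have "F2_lin_indep (insert v B)"
    unfolding F2_lin_indep_def
  proof (intro conjI allI impI fin)
    fix S assume S: "S \<subseteq> insert v B" "S \<noteq> {}"
    show "sum id S \<noteq> 0"
    proof (cases "v \<in> S")
      case True
      then show ?thesis using split[of S] sub'[OF S(1)] ext(2) by (auto simp: add_eq_zero_iff)
    next
      case False
      then have "S \<subseteq> B" using S by auto
      then show ?thesis using B(1) S(2) by (auto simp: F2_lin_indep_def)
    qed
  qed
  moreover have "2 ^ card (insert v B) = card (ext H v)"
    using vB B(2) by (simp add: card_ext[OF ext(1,2)])
  moreover have "ext H v = {sum id S | S. S \<subseteq> insert v B}"
  proof (intro equalityI subsetI)
    fix x assume "x \<in> ext H v"
    then consider "x \<in> H" | "v + x \<in> H" by (auto simp: ext_mem_iff)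
    then show "x \<in> {sum id S | S. S \<subseteq> insert v B}"
    proof cases
      case 1
      then show ?thesis using B(3) by auto
    next
      case 2
      then obtain S where S: "S \<subseteq> B" "v + x = sum id S" using B(3) by auto
      then have "v \<notin> S" using vB by auto
      then have "sum id (insert v S) = v + (v + x)" by (simp add: S(2))
      then have "x = sum id (insert v S)" by simp
      then show ?thesis using S(1) by blast
    qed
  next
    fix x assume "x \<in> {sum id S | S. S \<subseteq> insert v B}"
    then obtain S where S: "S \<subseteq> insert v B" "x = sum id S" by auto
    then have "x = (if v \<in> S then v + sum id (S - {v}) else sum id (S - {v}))"
      by (simp only: split[symmetric])
    then show "x \<in> ext H v" using sub'[OF S(1)] by (cases "v \<in> S") (simp_all add: ext_mem_iff)
  qed
  ultimately show ?case by (intro exI[of _ "insert v B"] conjI)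
qed

lemma Zr_not_sum_free:
  assumes "Zr k \<noteq> {}"
  shows "\<not> sum_free_order k (f_inv :: 'a \<Rightarrow> 'a)"
proof -
  obtain E where E: "E \<in> Zr k" using assms by auto
  then have Ek: "subsp E" "card E = 2 ^ k" by (auto simp: Zr_def Gr_def)
  obtain B where B: "F2_lin_indep B" "2 ^ card B = card E" "E = {sum id S | S. S \<subseteq> B}"
    using exists_basis[OF Ek(1)] by auto
  then have "affine_subspace_dim k E"
    unfolding affine_subspace_dim_def using Ek(2)
    by (intro exI[of _ "0 :: 'a"] exI[of _ B]) simp
  moreover have "(\<Sum>x\<in>E. f_inv x) = (\<Sum>x\<in>E. inverse x)"
    by (rule sum.cong) (auto simp: f_inv_def)
  ultimately show ?thesis
    using sum_inverse_Zr[OF E] by (auto simp: sum_free_order_def)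
qed

subsection \<open>Estimates\<close>

text \<open>Cauchy-Schwarz over all pairs \<open>(E, u)\<close> at once.\<close>

lemma Psi_square_le:
  "(Psi j f)^2 \<le> gr j * (q / 2 ^ j - 1) * Psi j (\<lambda>a. (f a)^2)"
proof -
  let ?A = "Sigma (Gr j) (\<lambda>E. range (L E) - {0})"
  have "real (card ?A) = gr j * (q / 2 ^ j - 1)"
    by (simp add: card_range_L_Gr gr_def)
  moreover have Psi_eq: "Psi j f = (\<Sum>(E, u)\<in>?A. f (sig E * u))" for f
    unfolding Psi_def by (rule sum.Sigma) simp_all
  ultimately show ?thesis
    using sum_squared_le_sum_of_squares[of "\<lambda>(E, u). f (sig E * u)" ?A]
    by (simp add: case_prod_unfold mult.commute)
qed

text \<open>Cauchy-Schwarz for each \<open>E\<close> separately: if \<open>sig E \<noteq> 0\<close>,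
  the sum of squares is extended to the whole field; if \<open>sig E = 0\<close>, all terms equal
  \<open>F 0\<close>.\<close>

lemma Psi_le:
  assumes B: "F 0 \<le> B" and X: "0 \<le> X" "q / 2 ^ j * (\<Sum>a\<in>UNIV. (F a)^2) \<le> X^2"
  shows "Psi j F \<le> zr j * ((q / 2 ^ j - 1) * B) + gr j * X"
proof -
  have inner: "(\<Sum>u\<in>range (L E) - {0}. F (sig E * u)) \<le> (if sig E = 0 then (q / 2 ^ j - 1) * B else 0) + X"
    if E: "E \<in> Gr j" for E
  proof (cases "sig E = 0")
    case True
    have "0 \<le> q / 2 ^ j - 1" using card_range_L_Gr[OF E] by (metis of_nat_0_le_iff)
    then have "(q / 2 ^ j - 1) * F 0 \<le> (q / 2 ^ j - 1) * B" using B by (rule mult_left_mono[rotated])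
    then show ?thesis using True X by (simp add: card_range_L_Gr[OF E])
  next
    case False
    let ?A = "range (L E) - {0}"
    have "(\<Sum>u\<in>?A. F (sig E * u))^2 \<le> card ?A * (\<Sum>u\<in>?A. (F (sig E * u))^2)"
      using sum_squared_le_sum_of_squares[of "\<lambda>u. F (sig E * u)" ?A] by (simp add: mult.commute)
    also have "\<dots> \<le> q / 2 ^ j * (\<Sum>u\<in>UNIV. (F (sig E * u))^2)"
      by (intro mult_mono sum_mono2) (auto simp: card_range_L_Gr[OF E] sum_nonneg)
    also have "\<dots> \<le> X^2"
      using X(2) sum_scale[OF False, of "\<lambda>a. (F a)^2"] by simp
    finally show ?thesis using False X(1) by (simp add: power2_le_iff_abs_le)
  qed
  have "Psi j F \<le> (\<Sum>E\<in>Gr j. (if sig E = 0 then (q / 2 ^ j - 1) * B else 0) + X)"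
    unfolding Psi_def by (rule sum_mono) (rule inner)
  also have "\<dots> = (\<Sum>E\<in>Gr j. if sig E = 0 then (q / 2 ^ j - 1) * B else 0) + gr j * X"
    by (simp add: sum.distrib gr_def)
  also have "(\<Sum>E\<in>Gr j. if sig E = 0 then (q / 2 ^ j - 1) * B else 0) = zr j * ((q / 2 ^ j - 1) * B)"
    by (subst sum.inter_filter[symmetric]) (simp_all add: Zr_def zr_def)
  finally show ?thesis by simp
qed

lemma Psi_nonneg: "(\<And>a. 0 \<le> f a) \<Longrightarrow> 0 \<le> Psi j f"
  unfolding Psi_def by (intro sum_nonneg) auto

lemma zr_nonneg [simp]: "0 \<le> zr j" and gr_nonneg [simp]: "0 \<le> gr j"
  by (simp_all add: gr_def zr_def)

lemma zr_le_gr: "zr j \<le> gr j"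
  unfolding gr_def zr_def by (intro of_nat_mono card_mono) (auto simp: Zr_def)

text \<open>\<open>zr_Suc\<close> and \<open>gr_Suc\<close> compare both counts with
  \<open>gr j\<close>.\<close>

lemma zr_Suc_le:
  assumes "2 ^ j \<le> real q"
  shows "zr (Suc j) * (q / 2 ^ j - 1) \<le> gr (Suc j)"
proof -
  have pos: "0 < (2 :: real) ^ Suc j - 1"
    using one_le_power[of "2 :: real" j] unfolding power_Suc by linarith
  have "zr (Suc j) * (2 ^ Suc j - 1) * (q / 2 ^ j - 1) \<le> gr j * (q / 2 ^ j - 1)"
    using assms by (intro mult_right_mono zr_Suc) simp
  then have "(zr (Suc j) * (q / 2 ^ j - 1)) * (2 ^ Suc j - 1) \<le> gr (Suc j) * (2 ^ Suc j - 1)"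
    by (simp only: gr_Suc mult_ac)
  then show ?thesis using pos by (rule mult_right_le_imp_le)
qed

lemma gr_mono:
  assumes "2 ^ j * 2 ^ Suc j \<le> real q"
  shows "gr j \<le> gr (Suc j)"
proof -
  have pos: "0 < (2 :: real) ^ Suc j - 1"
    using one_le_power[of "2 :: real" j] unfolding power_Suc by linarith
  have "2 ^ Suc j - 1 \<le> q / 2 ^ j - 1" using assms by (simp add: field_simps)
  then have "gr j * (2 ^ Suc j - 1) \<le> gr (Suc j) * (2 ^ Suc j - 1)"
    unfolding gr_Suc by (intro mult_left_mono) auto
  then show ?thesis using pos by (rule mult_right_le_imp_le)
qed

text \<open>For positive \<open>j\<close> this is \<open>zr_Suc_le\<close> followed by
  \<open>gr_mono\<close>; \<open>j = 0\<close> has no predecessor and rests on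
  \<open>gr 1 = gr 0 * (q - 1)\<close>.\<close>

lemma zr_le_gr_Suc:
  assumes "2 ^ j * 2 ^ Suc j \<le> real q"
  shows "zr j * (q / 2 ^ j - 1) \<le> gr (Suc j)"
proof (cases j)
  case 0
  then show ?thesis
    using gr_Suc[of 0] zr_le_gr[of 0] assms by (simp add: mult_right_mono)
next
  case (Suc l)
  have l: "2 ^ l \<le> real q"
  proof -
    have "(2 :: real) ^ l * 1 \<le> 2 ^ l * (8 * 2 ^ l)"
      using one_le_power[of "2 :: real" l] by (intro mult_left_mono) linarith+
    also have "\<dots> \<le> q" using assms by (simp add: Suc mult_ac)
    finally show ?thesis by simp
  qed
  have "zr j * (q / 2 ^ j - 1) \<le> zr j * (q / 2 ^ l - 1)"
    by (intro mult_left_mono) (simp_all add: Suc field_simps)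
  also have "\<dots> \<le> gr j" unfolding Suc by (rule zr_Suc_le[OF l])
  also have "\<dots> \<le> gr (Suc j)" by (rule gr_mono[OF assms])
  finally show ?thesis .
qed

section \<open>Fourier bounds for \<open>f1\<close> and for the square of
  \<open>U f1\<close>\<close>

lemma fourier_le_fourier_zero:
  assumes "\<And>a. 0 \<le> f a"
  shows "fourier f b \<le> fourier f 0"
proof -
  have "psi (b * v) * f v \<le> f v" for v
    using psi_cases[of "b * v"] assms[of v] by auto
  then show ?thesis unfolding fourier_def by (intro sum_mono) simp
qed

text \<open>One term is at most the whole moment; the exponent 3/4 this gives, in place of Weil's
  1/2, suffices below.\<close>

lemma fourier_f1_bound: "(fourier f1 b)^4 \<le> 5 * real q ^ 3"
proof -
  have "(fourier f1 b)^4 \<le> (\<Sum>b\<in>UNIV. (fourier f1 b)^4)"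
    by (rule member_le_sum) auto
  then show ?thesis using fourth_moment by linarith
qed

lemma fourier_square_U_f1_zero: "fourier (\<lambda>a. (U f1 a)^2) 0 = real q ^ 2"
proof -
  have "fourier (\<lambda>a. (U f1 a)^2) 0 = (\<Sum>b\<in>UNIV. (fourier f1 b)^2)"
    by (simp add: fourier_def sum_U_power)
  also have "\<dots> = q * (\<Sum>a\<in>UNIV. (f1 a)^2)" by (rule parseval)
  also have "\<dots> = real q ^ 2" by (simp add: f1_def power2_eq_square)
  finally show ?thesis .
qed

lemma second_moment_U_square:
  "(\<Sum>a\<in>UNIV. (U (\<lambda>a. (U f1 a)^2) a)^2) \<le> 5 * real q ^ 4"
proof -
  have "(\<Sum>a\<in>UNIV. (U (\<lambda>a. (U f1 a)^2) a)^2) = q * (\<Sum>a\<in>UNIV. ((U f1 a)^2)^2)"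
    by (simp only: sum_U_power parseval)
  also have "(\<Sum>a\<in>UNIV. ((U f1 a)^2)^2) = (\<Sum>b\<in>UNIV. (fourier f1 b)^4)"
    using sum_U_power[of f1 4] by simp
  also have "q * \<dots> \<le> q * (5 * real q ^ 3)"
    by (intro mult_left_mono fourth_moment) simp
  also have "\<dots> = 5 * real q ^ 4" by (simp add: power_numeral_reduce)
  finally show ?thesis .
qed

lemma f1_zero_abs: "\<bar>f1 0\<bar> = 1"
  by (simp add: f1_def)

lemma fourier_indicator_zero: "fourier (\<lambda>a. if a = 1 then 1 else 0) 0 = 1"
  by (simp add: fourier_def)

lemma Psi_indicator_Suc:
  "2 ^ Suc j * Psi (Suc j) (\<lambda>a. if a = 1 then 1 else 0)
    = gr (Suc j) - 2 ^ Suc j * zr (Suc j) + Psi j f1"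
  unfolding Psi_Suc U_indicator fourier_indicator_zero by simp

text \<open>\<open>fourier f1 0 = 0\<close> removes one term of \<open>Psi_Suc\<close>. In another,
  \<open>f1 0\<close> is a sign and \<open>q * zr (Suc j)\<close> lies between 0 and
  \<open>2 ^ Suc j * gr (Suc j)\<close>.\<close>

lemma Psi_f1_Suc:
  assumes "2 ^ Suc j \<le> real q"
  shows "2 ^ Suc j * Psi (Suc j) f1 \<ge> - (2 ^ Suc j * gr (Suc j)) - \<bar>Psi j (U f1)\<bar>"
proof -
  have "q / 2 ^ Suc j \<le> q / 2 ^ j - 1" using assms by (simp add: field_simps)
  then have "zr (Suc j) * (q / 2 ^ Suc j) \<le> zr (Suc j) * (q / 2 ^ j - 1)"
    by (intro mult_left_mono) auto
  also have "\<dots> \<le> gr (Suc j)"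
    using assms zero_le_power[of "2 :: real" j] unfolding power_Suc
    by (intro zr_Suc_le) linarith
  finally have "q * zr (Suc j) \<le> 2 ^ Suc j * gr (Suc j)"
    by (simp add: field_simps)
  moreover have "0 \<le> q * zr (Suc j)" by simp
  ultimately have "\<bar>q * zr (Suc j) - 2 ^ Suc j * gr (Suc j)\<bar> \<le> 2 ^ Suc j * gr (Suc j)"
    by linarith
  then have "\<bar>f1 0 * (q * zr (Suc j) - 2 ^ Suc j * gr (Suc j))\<bar> \<le> 2 ^ Suc j * gr (Suc j)"
    by (simp only: abs_mult f1_zero_abs mult_1)
  then show ?thesis
    unfolding Psi_Suc by (simp add: fourier_f1_zero)
qed

section \<open>Positivity of the count\<close>

lemma Psi_2_pos:
  assumes q: "2048 \<le> real q"
  shows "0 < Psi 2 (\<lambda>a. if a = 1 then 1 else 0)"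
proof -
  let ?Q = "real q"
  define x where "x = fourier f1 1"
  have "x^4 \<le> 5 * ?Q ^ 3" unfolding x_def by (rule fourier_f1_bound)
  \<comment> \<open>\<open>256 = 4 ^ 4\<close>, and \<open>5 * 256 = 1280\<close> is below
    2048.\<close>
  also have "\<dots> \<le> (?Q / 256) * ?Q ^ 3" using q by (intro mult_right_mono) auto
  also have "\<dots> = (?Q / 4)^4" by (simp add: power_numeral_reduce)
  finally have "\<bar>x\<bar> ^ 4 \<le> (?Q / 4)^4" by simp
  then have x: "\<bar>x\<bar> \<le> ?Q / 4" by (rule power_le_imp_le_base[of _ 3, simplified]) simp
  have g0: "gr 0 = 1" by (simp add: gr_def Gr_0)
  have g1: "gr 1 = ?Q - 1" using gr_Suc[of 0] g0 by simp
  have "gr 2 * 3 = (?Q - 1) * (?Q / 2 - 1)"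
    using gr_Suc[of 1] g1 by (simp add: numeral_2_eq_2)
  moreover have "zr 2 * 3 \<le> ?Q - 1"
    using zr_Suc[of 1] g1 by (simp add: numeral_2_eq_2)
  ultimately have "(?Q - 1) * (?Q / 2 - 1) - 4 * (?Q - 1) \<le> gr 2 * 3 - 4 * (zr 2 * 3)"
    by (intro diff_mono) simp_all
  then have g2: "3 * (gr 2 - 4 * zr 2) \<ge> (?Q - 1) * (?Q / 2 - 1) - 4 * (?Q - 1)"
    by (simp only: right_diff_distrib mult_ac)
  \<comment> \<open>The only subspace is \<open>{0}\<close> and \<open>sig {0} = 0\<close>, so all
    \<open>q - 1\<close> terms equal \<open>U f1 0 = fourier f1 1\<close>.\<close>
  have "Psi 0 (U f1) = (?Q - 1) * x"
    using card_range_L_Gr[of "{0}" 0]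
    by (simp add: Psi_def Gr_0 sig_0 U_def x_def)
  then have "\<bar>Psi 0 (U f1)\<bar> \<le> (?Q - 1) * (?Q / 4)"
    using q x by (simp add: abs_mult mult_left_mono)
  then have "2 * Psi 1 f1 \<ge> - (2 * (?Q - 1)) - (?Q - 1) * (?Q / 4)"
    using Psi_f1_Suc[of 0] q g1 by simp
  moreover have "4 * Psi 2 (\<lambda>a. if a = 1 then 1 else 0) = gr 2 - 4 * zr 2 + Psi 1 f1"
    using Psi_indicator_Suc[of 1] by (simp add: numeral_2_eq_2)
  \<comment> \<open>The factor 24 clears the denominators 4, 2 and 3 of the three bounds.\<close>
  moreover have "2 * a - 3 * c - 3 * b \<le> 24 * S"
    if "- c - b \<le> 2 * P" "4 * S = G + P" "a \<le> 3 * G" for a b c G P S :: real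
    using that by linarith
  ultimately have "24 * Psi 2 (\<lambda>a. if a = 1 then 1 else 0)
      \<ge> 2 * ((?Q - 1) * (?Q / 2 - 1) - 4 * (?Q - 1)) - 3 * (2 * (?Q - 1)) - 3 * ((?Q - 1) * (?Q / 4))"
    using g2 by blast
  also have "2 * ((?Q - 1) * (?Q / 2 - 1) - 4 * (?Q - 1)) - 3 * (2 * (?Q - 1)) - 3 * ((?Q - 1) * (?Q / 4))
      = (?Q - 1) * (?Q / 4 - 16)"
    by (simp add: field_simps)
  finally have "(?Q - 1) * (?Q / 4 - 16) \<le> 24 * Psi 2 (\<lambda>a. if a = 1 then 1 else 0)" .
  moreover have "0 < (?Q - 1) * (?Q / 4 - 16)" using q by (intro mult_pos_pos) auto
  ultimately show ?thesis by linarith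
qed

text \<open>The recursion visits the indicator, \<open>f1\<close> and \<open>U f1\<close> in
  dimensions \<open>i + 3\<close>, \<open>i + 2\<close> and \<open>i + 1\<close>. There
  Cauchy-Schwarz passes to \<open>h\<close>, whose own step ends at \<open>U h\<close> in dimension
  \<open>i\<close>.\<close>

lemma Psi_pos:
  assumes q: "2 ^ 16 * (2 ^ i) ^ 4 \<le> real q"
  shows "0 < Psi (i + 3) (\<lambda>a. if a = 1 then 1 else 0)"
proof -
  define t Q r :: real where "t = 2 ^ i" and "Q = q" and "r = sqrt q"
  define h where "h = (\<lambda>a. (U f1 a)^2)"
  have t: "1 \<le> t" by (simp add: t_def)
  have Q: "65536 * t^4 \<le> Q" using q by (simp add: t_def Q_def)
  have t_le: "t \<le> t^2" "t^2 \<le> t^3" "t^3 \<le> t^4" using t by (auto intro: power_increasing)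
      (use t in \<open>auto simp: power2_eq_square\<close>)
  have Q0: "0 \<le> Q" by (simp add: Q_def)
  have Qr: "Q = r^2" "0 \<le> r" by (simp_all add: Q_def r_def)
  have "(256 * t^2)^2 \<le> r^2" using Q by (simp add: Qr(1)[symmetric] power_mult_distrib)
  then have r: "256 * t^2 \<le> r" using Qr(2) by (rule power2_le_imp_le)
  define g0 g1 g2 g3 where "g0 = gr i" and "g1 = gr (i + 1)" and "g2 = gr (i + 2)" and "g3 = gr (i + 3)"
  define z0 z1 z2 z3 where "z0 = zr i" and "z1 = zr (i + 1)" and "z2 = zr (i + 2)" and "z3 = zr (i + 3)"
  have nonneg: "0 \<le> g0" "0 \<le> g1" "0 \<le> g2" "0 \<le> g3" "0 \<le> z0" "0 \<le> z1" "0 \<le> z2" "0 \<le> z3"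
    by (simp_all add: g0_def g1_def g2_def g3_def z0_def z1_def z2_def z3_def)
  have G1: "g1 * (2 * t - 1) = g0 * (Q / t - 1)"
    using gr_Suc[of i] by (simp add: g0_def g1_def t_def Q_def)
  have G2: "g2 * (4 * t - 1) = g1 * (Q / (2 * t) - 1)"
    using gr_Suc[of "i + 1"] by (simp add: g1_def g2_def t_def Q_def)
  have G3: "g3 * (8 * t - 1) = g2 * (Q / (4 * t) - 1)"
    using gr_Suc[of "i + 2"] by (simp add: g2_def g3_def t_def Q_def eval_nat_numeral)
  have Z3: "z3 * (8 * t - 1) \<le> g2"
    using zr_Suc[of "i + 2"] by (simp add: g2_def z3_def t_def eval_nat_numeral)
  have Q1: "Q / (2 * t) \<le> Q / t - 1" "Q / (4 * t) \<le> Q / (2 * t) - 1" "Q / (8 * t) \<le> Q / (4 * t) - 1"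
    using Q t t_le by (simp_all add: field_simps)

  \<comment> \<open>Here and in the next two bounds, \<open>gr (Suc j) / gr j\<close> is at least
    \<open>q / (2 ^ Suc j)^2\<close>.\<close>
  have g01: "g0 * Q \<le> 4 * t^2 * g1"
  proof -
    have "g0 * (Q / (2 * t)) \<le> g0 * (Q / t - 1)" using Q1 nonneg by (intro mult_left_mono) auto
    also have "\<dots> = g1 * (2 * t - 1)" by (simp add: G1)
    also have "\<dots> \<le> g1 * (2 * t)" using nonneg by (intro mult_left_mono) auto
    finally show ?thesis using t by (simp add: field_simps power2_eq_square)
  qed
  have g12: "g1 * Q \<le> 16 * t^2 * g2"
  proof -
    have "g1 * (Q / (4 * t)) \<le> g1 * (Q / (2 * t) - 1)" using Q1 nonneg by (intro mult_left_mono) auto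
    also have "\<dots> = g2 * (4 * t - 1)" by (simp add: G2)
    also have "\<dots> \<le> g2 * (4 * t)" using nonneg by (intro mult_left_mono) auto
    finally show ?thesis using t by (simp add: field_simps power2_eq_square)
  qed
  have g23: "g2 * Q \<le> 64 * t^2 * g3"
  proof -
    have "g2 * (Q / (8 * t)) \<le> g2 * (Q / (4 * t) - 1)" using Q1 nonneg by (intro mult_left_mono) auto
    also have "\<dots> = g3 * (8 * t - 1)" by (simp add: G3)
    also have "\<dots> \<le> g3 * (8 * t)" using nonneg by (intro mult_left_mono) auto
    finally show ?thesis using t by (simp add: field_simps power2_eq_square)
  qed

  \<comment> \<open>\<open>Q^3 / (4 * t^2)\<close> is chosen so that, by \<open>g01\<close>,
    \<open>g0\<close> times it is at most \<open>g1 * Q^2\<close>; the inequality comes down to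
    \<open>80 * t^3 \<le> Q\<close>.\<close>
  have X: "Q / t * (5 * Q^4) \<le> (Q^3 / (4 * t^2))^2"
  proof -
    have "80 * t^3 \<le> Q" using Q t_le t by simp
    then have "80 * t^3 * Q^5 \<le> Q * Q^5" using Q0 by (intro mult_right_mono) auto
    then show ?thesis using t by (simp add: field_simps power_numeral_reduce)
  qed
  have "Psi i (U h) \<le> z0 * ((Q / t - 1) * Q^2) + g0 * (Q^3 / (4 * t^2))"
    unfolding z0_def g0_def t_def Q_def
  proof (rule Psi_le)
    have "U h 0 \<le> fourier h 0"
      unfolding U_def by (rule fourier_le_fourier_zero) (simp add: h_def)
    then show "U h 0 \<le> real q ^ 2" by (simp add: h_def fourier_square_U_f1_zero)
    show "q / 2 ^ i * (\<Sum>a\<in>UNIV. (U h a)^2) \<le> (real q ^ 3 / (4 * (2 ^ i)^2))^2"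
      by (rule order_trans[OF mult_left_mono X[unfolded t_def Q_def]])
        (use second_moment_U_square in \<open>simp_all add: h_def\<close>)
  qed simp
  moreover have "z0 * (Q / t - 1) * Q^2 \<le> g1 * Q^2"
  proof (rule mult_right_mono)
    have "2 * t^2 \<le> Q" using Q t_le t by linarith
    then have "2 ^ i * 2 ^ Suc i \<le> real q"
      by (simp add: t_def Q_def power2_eq_square mult_ac)
    from zr_le_gr_Suc[OF this] show "z0 * (Q / t - 1) \<le> g1"
      by (simp add: z0_def g1_def t_def Q_def)
  qed simp
  moreover have "g0 * (Q^3 / (4 * t^2)) \<le> g1 * Q^2"
  proof -
    have "g0 * Q * Q^2 \<le> 4 * t^2 * g1 * Q^2" by (rule mult_right_mono[OF g01]) simp
    then show ?thesis using t by (simp add: field_simps power_numeral_reduce)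
  qed
  ultimately have Psi_i: "Psi i (U h) \<le> 2 * (g1 * Q^2)" by (simp only: mult.assoc)

  \<comment> \<open>\<open>h 0\<close> is \<open>(fourier f1 1)^2\<close>, at most of order
    \<open>Q^(3/2)\<close>, while \<open>Q * z1 \<le> 2 * t * g1\<close>.\<close>
  have h0: "0 \<le> h 0" "h 0 * (Q * z1) \<le> g1 * Q^2"
  proof -
    show "0 \<le> h 0" by (simp add: h_def)
    have "(h 0)^2 \<le> 5 * Q^3"
      using fourier_f1_bound[of 1] power_mult[of "fourier f1 1" 2 2] by (simp add: h_def U_def Q_def)
    then have "(h 0 * (2 * t))^2 \<le> 5 * Q^3 * (2 * t)^2"
      unfolding power_mult_distrib by (intro mult_right_mono) auto
    also have "\<dots> = (20 * t^2) * Q^3" by (simp add: power_mult_distrib)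
    also have "\<dots> \<le> Q * Q^3" using Q Q0 t_le t by (intro mult_right_mono) auto
    also have "\<dots> = (Q^2)^2" by (simp add: power_numeral_reduce)
    finally have h0t: "h 0 * (2 * t) \<le> Q^2" by (rule power2_le_imp_le) simp
    have "z1 * (Q / (2 * t)) \<le> z1 * (Q / t - 1)" using Q1 nonneg by (intro mult_left_mono) auto
    also have "\<dots> \<le> g1"
      using zr_Suc_le[of i] Q t_le t by (simp add: z1_def g1_def t_def[symmetric] Q_def[symmetric])
    finally have "Q * z1 \<le> 2 * t * g1" using t by (simp add: field_simps)
    then have "h 0 * (Q * z1) \<le> h 0 * (2 * t * g1)" by (rule mult_left_mono) (simp add: h_def)
    also have "\<dots> = g1 * (h 0 * (2 * t))" by simp
    also have "\<dots> \<le> g1 * Q^2" using h0t nonneg by (intro mult_left_mono)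
    finally show "h 0 * (Q * z1) \<le> g1 * Q^2" .
  qed
  have "2 * t * Psi (i + 1) h = h 0 * (Q * z1) - 2 * t * (h 0 * g1) + g1 * Q^2 - 2 * t * (z1 * Q^2) + Psi i (U h)"
    using Psi_Suc[of i h]
    by (simp add: h_def fourier_square_U_f1_zero g1_def z1_def t_def Q_def algebra_simps)
  moreover have "0 \<le> 2 * t * (h 0 * g1)" "0 \<le> 2 * t * (z1 * Q^2)"
    using t h0(1) nonneg by simp_all
  ultimately have Psi_h: "t * Psi (i + 1) h \<le> 2 * (g1 * Q^2)"
    using h0(2) Psi_i by linarith

  have "(Psi (i + 1) (U f1))^2 \<le> g1 * (Q / (2 * t) - 1) * Psi (i + 1) h"
    using Psi_square_le[of "i + 1" "U f1"] by (simp add: h_def g1_def t_def Q_def)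
  also have "\<dots> \<le> (g2 * (4 * t)) * Psi (i + 1) h"
    unfolding G2[symmetric] using nonneg
    by (intro mult_right_mono mult_left_mono Psi_nonneg) (auto simp: h_def)
  also have "\<dots> = 4 * g2 * (t * Psi (i + 1) h)" by simp
  also have "\<dots> \<le> 4 * g2 * (2 * (g1 * Q^2))"
    using Psi_h nonneg by (intro mult_left_mono) auto
  also have "\<dots> = 8 * g2 * Q * (g1 * Q)" by (simp add: power2_eq_square)
  also have "\<dots> \<le> 8 * g2 * Q * (16 * t^2 * g2)"
    using g12 nonneg Q0 by (intro mult_left_mono) auto
  also have "\<dots> = 128 * (t * g2 * r)^2"
    by (simp add: Qr(1) power_mult_distrib power2_eq_square)
  \<comment> \<open>128 is rounded up to the square 144, so that the root divided by
    \<open>4 * t\<close> is \<open>3 * g2 * r\<close>.\<close>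
  also have "\<dots> \<le> 144 * (t * g2 * r)^2" by simp
  also have "\<dots> = (12 * t * g2 * r)^2" by (simp add: power_mult_distrib)
  finally have "\<bar>Psi (i + 1) (U f1)\<bar> \<le> 12 * t * g2 * r"
    using t nonneg Qr(2) by (simp add: power2_le_iff_abs_le)
  moreover have "4 * t * Psi (i + 2) f1 \<ge> - (4 * t * g2) - \<bar>Psi (i + 1) (U f1)\<bar>"
    using Psi_f1_Suc[of "i + 1"] Q t t_le
    by (simp add: g2_def t_def[symmetric] Q_def[symmetric])
  ultimately have "4 * t * Psi (i + 2) f1 \<ge> 4 * t * (- g2 - 3 * (g2 * r))"
    by (simp add: algebra_simps)
  then have "Psi (i + 2) f1 \<ge> - g2 - 3 * (g2 * r)"
    using t by (simp only: mult_le_cancel_left_pos)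
  moreover have "8 * t * Psi (i + 3) (\<lambda>a. if a = 1 then 1 else 0) = g3 - 8 * t * z3 + Psi (i + 2) f1"
    using Psi_indicator_Suc[of "i + 2"] by (simp add: g3_def z3_def t_def eval_nat_numeral)
  moreover have "8 * t * z3 \<le> 2 * g2"
  proof -
    have "z3 * (8 * t) \<le> z3 * (2 * (8 * t - 1))" using t nonneg by (intro mult_left_mono) auto
    then show ?thesis using Z3 by (simp add: algebra_simps)
  qed
  \<comment> \<open>Here \<open>2 ^ 16\<close> enters: \<open>r \<ge> 256 * t^2\<close> and
    \<open>64 * t^2 * g3 \<ge> g2 * r^2\<close>. The 4 beats the coefficient 3 of the error, and the
    surplus \<open>g2 * r\<close> covers the remaining \<open>3 * g2\<close>.\<close>
  moreover have "4 * (g2 * r) \<le> g3"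
  proof -
    have "64 * t^2 * (4 * (g2 * r)) = (g2 * r) * (256 * t^2)" by simp
    also have "\<dots> \<le> (g2 * r) * r" using r nonneg Qr(2) by (intro mult_left_mono) auto
    also have "\<dots> \<le> 64 * t^2 * g3" using g23 by (simp add: Qr(1) power2_eq_square)
    finally show ?thesis using t by (simp add: mult_le_cancel_left)
  qed
  moreover have "3 * g2 < g2 * r"
  proof -
    have "0 < g2"
    proof -
      have pos: "0 < gr j" if "2 ^ j < real q" for j
        using that
      proof (induction j)
        case 0
        show ?case by (simp add: gr_def Gr_0)
      next
        case (Suc j)
        have "2 ^ j < real q" using Suc.prems zero_le_power[of "2 :: real" j] unfolding power_Suc by linarith
        then have "0 < gr j * (q / 2 ^ j - 1)" using Suc.IH by simp
        then have "0 < gr (Suc j) * (2 ^ Suc j - 1)" by (simp only: gr_Suc)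
        then show ?case using gr_nonneg[of "Suc j"] by (auto simp: zero_less_mult_iff)
      qed
      show ?thesis unfolding g2_def
        by (rule pos) (use Q t t_le in \<open>simp add: t_def[symmetric] Q_def[symmetric]\<close>)
    qed
    moreover have "3 < r" using r t t_le by linarith
    ultimately show ?thesis by (simp add: mult.commute)
  qed
  ultimately have "0 < 8 * t * Psi (i + 3) (\<lambda>a. if a = 1 then 1 else 0)" by linarith
  then show ?thesis using t by (simp add: zero_less_mult_iff)
qed

end

theorem theorem4:
  fixes n k :: nat
  assumes "card (UNIV :: ('a::{field,finite}) set) = 2 ^ n"
    and "k \<ge> 3"
    and "3 * n + 6 \<ge> 13 * k"
  shows "\<not> sum_free_order k (f_inv :: 'a \<Rightarrow> 'a)"
proof -
  \<comment> \<open>Translation by 1 permutes the field, so its cardinality \<open>2 ^ n\<close> is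
    0 in it, which forces characteristic 2.\<close>
  have "(\<Sum>x\<in>UNIV. x + (1::'a)) = (\<Sum>x\<in>UNIV. x)"
    by (rule sum.reindex_bij_witness[of _ "\<lambda>x. x - 1" "\<lambda>x. x + 1"]) auto
  then have "(2::'a) ^ n = 0"
    using assms(1) by (simp add: sum.distrib)
  then have two: "(1::'a) + 1 = 0" by simp
  interpret char2_field "TYPE('a)" "2 ^ n"
    using two assms(1) by unfold_locales
  have "Zr k \<noteq> {}"
  proof (cases "k = 3")
    case True
    \<comment> \<open>For \<open>k = 3\<close> this is just short of
      \<open>n \<ge> 4 * k = 12\<close>.\<close>
    then have "11 \<le> n" using assms(3) by simp
    then have "(2 :: real) ^ 11 \<le> 2 ^ n" by (intro power_increasing) auto
    then have "0 < Psi 2 (\<lambda>a. if a = 1 then 1 else 0)" by (intro Psi_2_pos) simp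
    then show ?thesis using exists_ext_sig_zero[of 2] True by (simp add: eval_nat_numeral)
  next
    case False
    define i where "i = k - 4"
    \<comment> \<open>\<open>16 + i * 4\<close> is \<open>4 * k\<close>. For
      \<open>k \<ge> 6\<close> it follows from \<open>13 * k - 6 \<ge> 12 * k\<close>; for
      \<open>k = 4\<close> and \<open>k = 5\<close> the bounds \<open>46 / 3\<close> and
      \<open>59 / 3\<close> on \<open>n\<close> round up to 16 and 20.\<close>
    have k: "k = Suc (i + 3)" and n: "16 + i * 4 \<le> n"
      using assms(2,3) False by (auto simp: i_def)
    have "(2 :: real) ^ (16 + i * 4) \<le> 2 ^ n" using n by (intro power_increasing) auto
    then have "2 ^ 16 * (2 ^ i) ^ 4 \<le> real (2 ^ n)" by (simp add: power_add power_mult)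
    then show ?thesis using exists_ext_sig_zero[OF Psi_pos] k by simp
  qed
  then show ?thesis by (rule Zr_not_sum_free)
qed

end
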